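(* Let $(a_n)_{n\in\mathbb{N}}$ and $(b_{n,j})_{n,j\in\mathbb{N}}$ be real numbers with $a_n\ge 0$ for all $n$, $b_{n,j}\ge 0$ for all $n,j$, and $b_{n,j}=0$ whenever $n\ge j$. Assume that $a_1=0$ and $\sum_{n=1}^{j-1}nb_{n,j}=j$ for all $j=2,3,\ldots$. Let $w$ be a weight such that $w_n\ge n$ for all $n\in\mathbb{N}$ and such that there exists $\kappa\in(0,1]$ with $$\sum_{n=1}^{j-1}w_nb_{n,j}\le\kappa w_j\quad\text{for all } j=2,3,\ldots.\qquad(\ast)$$ (i) We have $\lim_{t\to\infty}\|S^{(w)}(t)\mathring{u}-M_1(\mathring{u})e_1\|_w=0$ for all $\mathring{u}\in\ell_w^1$ if and only if $a_n>0$ for all $n\ge2$. (ii) Suppose that $w$ is chosen such that $(\ast)$ holds with some $\kappa\in(0,1)$, and let $\widehat{a}_0:=\inf_{n\in\mathbb{N}:\,n\ge2}a_n$. Then (for this $\kappa$), for all $\mathring{u}\in\ell_w^1$ and $t\ge 0$, $$\|S^{(w)}(t)\mathring{u}-M_1(\mathring{u})e_1\|_w\le(w_1+1)e^{-(1-\kappa)\widehat{a}_0t}\|\mathring{u}\|_w,$$ and so $$\lim_{t\to\infty}e^{\alpha t}\|S^{(w)}(t)\mathring{u}-M_1(\mathring{u})e_1\|_w=0\quad\text{for all }\mathring{u}\in\ell_w^1,\qquad(\ast\ast)$$ whenever $\widehat{a}_0>0$ and $\alpha\in[0,(1-\kappa)\widehat{a}_0)$. The statement $(\ast\ast)$ does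 not hold (i.e. it fails for some $\mathring{u}\in\ell_w^1$) for any $\alpha>\widehat{a}_0$. In particular, if $\widehat{a}_0=0$, then $(\ast\ast)$ does not hold for any $\alpha>0$.
   Context: $\mathbb{N}=\{1,2,\ldots\}$. A weight is a sequence $w=(w_n)_{n=1}^\infty$ of strictly positive reals, and $\ell_w^1$ is the Banach space of sequences $f=(f_n)_{n=1}^\infty$ with $\|f\|_w=\sum_{n=1}^\infty w_n|f_n|<\infty$. $M_1(f)=\sum_{n=1}^\infty nf_n$, and $e_1=(1,0,0,\ldots)$. Operators: $A^{(w)}f=(-a_nf_n)_{n=1}^\infty$ with $\mathcal{D}(A^{(w)})=\{f\in\ell_w^1:(a_nf_n)_n\in\ell_w^1\}$; $B^{(w)}f=\bigl(\sum_{j=n+1}^\infty a_jb_{n,j}f_j\bigr)_{n=1}^\infty$ with $\mathcal{D}(B^{(w)})$ the set of $f\in\ell_w^1$ for which this sequence is well defined and lies in $\ell_w^1$. Under the stated hypotheses (with $\kappa\in(0,1]$), the closure $G^{(w)}=\overline{A^{(w)}+B^{(w)}}$ generates a substochastic $C_0$-semigroup on $\ell_w^1$ (positive, and contractive on the cone of componentwise non-negative sequences), denoted $(S^{(w)}(t))_{t\ge0}$. *)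

theory Defs
  imports "HOL-Analysis.Analysis"
begin

text \<open>
  A sequence indexed by {1, 2, ...} is a function on nat; only the values at arguments
  at least 1 carry information.  The elements of the weighted space below are normalised
  to vanish at 0, so that equality of sequences is equality of functions.
\<close>

definition weight :: "(nat \<Rightarrow> real) \<Rightarrow> bool" where
  "weight w \<longleftrightarrow> (\<forall>n\<ge>1. 0 < w n)"

definition ell1 :: "(nat \<Rightarrow> real) \<Rightarrow> (nat \<Rightarrow> real) set" where
  "ell1 w = {f. f 0 = 0 \<and> summable (\<lambda>n. w n * \<bar>f n\<bar>)}"

text \<open>On the weighted space the summand for index 0 vanishes, here and in the first moment.\<close>

definition ell1_norm :: "(nat \<Rightarrow> real) \<Rightarrow> (nat \<Rightarrow> real) \<Rightarrow> real" where
  "ell1_norm w f = (\<Sum>n. w n * \<bar>f n\<bar>)"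

definition M1 :: "(nat \<Rightarrow> real) \<Rightarrow> real" where
  "M1 f = (\<Sum>n. real n * f n)"

definition e1 :: "nat \<Rightarrow> real" where
  "e1 = (\<lambda>n. if n = 1 then 1 else 0)"

text \<open>
  Unbounded operators are given by their graphs: the pair (f, g) belongs to the operator
  iff f is in its domain and is mapped to g.
\<close>

type_synonym operator_graph = "((nat \<Rightarrow> real) \<times> (nat \<Rightarrow> real)) set"

definition A_op :: "(nat \<Rightarrow> real) \<Rightarrow> (nat \<Rightarrow> real) \<Rightarrow> operator_graph" where
  "A_op a w = {(f, g). f \<in> ell1 w \<and> g \<in> ell1 w \<and> g = (\<lambda>n. - a n * f n)}"

text \<open>The index j > n of the series is written as n + 1 + i.\<close>

definition B_op ::
    "(nat \<Rightarrow> real) \<Rightarrow> (nat \<Rightarrow> nat \<Rightarrow> real) \<Rightarrow> (nat \<Rightarrow> real) \<Rightarrow> operator_graph" where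
  "B_op a b w = {(f, g). f \<in> ell1 w \<and> g \<in> ell1 w \<and>
     (\<forall>n\<ge>1. (\<lambda>i. a (n + 1 + i) * b n (n + 1 + i) * f (n + 1 + i)) sums g n)}"

definition op_sum :: "operator_graph \<Rightarrow> operator_graph \<Rightarrow> operator_graph" where
  "op_sum P Q = {(f, \<lambda>n. g n + h n) | f g h. (f, g) \<in> P \<and> (f, h) \<in> Q}"

definition op_closure :: "(nat \<Rightarrow> real) \<Rightarrow> operator_graph \<Rightarrow> operator_graph" where
  "op_closure w P = {(f, g). f \<in> ell1 w \<and> g \<in> ell1 w \<and>
     (\<exists>F G. (\<forall>k::nat. (F k, G k) \<in> P) \<and>
       (\<lambda>k. ell1_norm w (\<lambda>n. F k n - f n)) \<longlonglongrightarrow> 0 \<and>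
       (\<lambda>k. ell1_norm w (\<lambda>n. G k n - g n)) \<longlonglongrightarrow> 0)}"

definition bounded_operator ::
    "(nat \<Rightarrow> real) \<Rightarrow> ((nat \<Rightarrow> real) \<Rightarrow> (nat \<Rightarrow> real)) \<Rightarrow> bool" where
  "bounded_operator w T \<longleftrightarrow>
     (\<forall>f\<in>ell1 w. T f \<in> ell1 w) \<and>
     (\<forall>f\<in>ell1 w. \<forall>g\<in>ell1 w. T (\<lambda>n. f n + g n) = (\<lambda>n. T f n + T g n)) \<and>
     (\<forall>c. \<forall>f\<in>ell1 w. T (\<lambda>n. c * f n) = (\<lambda>n. c * T f n)) \<and>
     (\<exists>C. \<forall>f\<in>ell1 w. ell1_norm w (T f) \<le> C * ell1_norm w f)"

definition C0_semigroup ::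
    "(nat \<Rightarrow> real) \<Rightarrow> (real \<Rightarrow> (nat \<Rightarrow> real) \<Rightarrow> (nat \<Rightarrow> real)) \<Rightarrow> bool" where
  "C0_semigroup w S \<longleftrightarrow>
     (\<forall>t\<ge>0. bounded_operator w (S t)) \<and>
     (\<forall>f\<in>ell1 w. S 0 f = f) \<and>
     (\<forall>s\<ge>0. \<forall>t\<ge>0. \<forall>f\<in>ell1 w. S (s + t) f = S s (S t f)) \<and>
     (\<forall>f\<in>ell1 w. ((\<lambda>t. ell1_norm w (\<lambda>n. S t f n - f n)) \<longlongrightarrow> 0) (at_right 0))"

definition generator ::
    "(nat \<Rightarrow> real) \<Rightarrow> (real \<Rightarrow> (nat \<Rightarrow> real) \<Rightarrow> (nat \<Rightarrow> real)) \<Rightarrow> operator_graph" where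
  "generator w S = {(f, g). f \<in> ell1 w \<and> g \<in> ell1 w \<and>
     ((\<lambda>t. ell1_norm w (\<lambda>n. (S t f n - f n) / t - g n)) \<longlongrightarrow> 0) (at_right 0)}"

definition generates ::
    "(nat \<Rightarrow> real) \<Rightarrow> operator_graph \<Rightarrow> (real \<Rightarrow> (nat \<Rightarrow> real) \<Rightarrow> (nat \<Rightarrow> real)) \<Rightarrow> bool" where
  "generates w G S \<longleftrightarrow> C0_semigroup w S \<and> generator w S = G"

definition weight_cond :: "(nat \<Rightarrow> nat \<Rightarrow> real) \<Rightarrow> (nat \<Rightarrow> real) \<Rightarrow> real \<Rightarrow> bool" where
  "weight_cond b w \<kappa> \<longleftrightarrow> (\<forall>j\<ge>2. (\<Sum>n = 1..j - 1. w n * b n j) \<le> \<kappa> * w j)"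

definition converges_at_rate ::
    "(nat \<Rightarrow> real) \<Rightarrow> (real \<Rightarrow> (nat \<Rightarrow> real) \<Rightarrow> (nat \<Rightarrow> real)) \<Rightarrow> real \<Rightarrow> bool" where
  "converges_at_rate w S \<alpha> \<longleftrightarrow>
     (\<forall>u\<in>ell1 w. ((\<lambda>t. exp (\<alpha> * t) * ell1_norm w (\<lambda>n. S t u n - M1 u * e1 n)) \<longlongrightarrow> 0) at_top)"

end

theory Submission
  imports Defs
begin

text \<open>
  Since \<open>G\<close> maps the \<open>m\<close>-th unit sequence to a combination of the first \<open>m\<close> unit sequences, the
  components \<open>p k m t\<close> of its orbit satisfy the triangular backward equations
  \<open>p k m' = a m * ((\<Sum>n<m. b n m * p k n) - p k m)\<close>. Every linear functional of the orbits satisfies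
  the same system, so one comparison principle, proved by induction on \<open>m\<close>, yields positivity,
  triangularity, conservation of mass, and the decay of the tail \<open>\<Sum>k\<ge>2. w k * p k m\<close> at rate
  \<open>(1 - \<kappa>) * a0\<close>; by conservation of mass the tail controls the distance to \<open>m * e1\<close>. As the norm
  of a bounded operator on a weighted \<open>\<ell>\<^sup>1\<close> space is determined by the unit sequences, the bounds extend to
  all initial states. If \<open>\<kappa> = 1\<close>, decay of each unit orbit still follows from the weight \<open>n\<^sup>2\<close>, and
  dominated convergence concludes. The diagonal entries \<open>p m m t = exp (- a m * t)\<close> rule out
  every rate above \<open>a0\<close>. That the orbits are differentiable from the left needs local boundedness of
  the semigroup, obtained from the uniform boundedness principle.
\<close>

section \<open>The weighted sequence space\<close>

lemma ell1_zero_term: "f \<in> ell1 w \<Longrightarrow> f 0 = 0"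
  by (simp add: ell1_def)

lemma ell1_summable: "f \<in> ell1 w \<Longrightarrow> summable (\<lambda>n. w n * \<bar>f n\<bar>)"
  by (simp add: ell1_def)

lemma weighted_term_nonneg:
  assumes "weight w" "f \<in> ell1 w"
  shows "0 \<le> w n * \<bar>f n\<bar>"
  using assms by (cases "n = 0") (auto simp: ell1_def weight_def less_imp_le)

lemma ell1_norm_nonneg: "weight w \<Longrightarrow> f \<in> ell1 w \<Longrightarrow> 0 \<le> ell1_norm w f"
  unfolding ell1_norm_def by (intro suminf_nonneg ell1_summable weighted_term_nonneg)

lemma weighted_sum_le_ell1_norm:
  assumes "weight w" "f \<in> ell1 w" "finite I"
  shows "(\<Sum>n\<in>I. w n * \<bar>f n\<bar>) \<le> ell1_norm w f"
  unfolding ell1_norm_def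
  using assms by (intro sum_le_suminf ell1_summable weighted_term_nonneg) auto

lemma weighted_term_le_ell1_norm:
  assumes "weight w" "f \<in> ell1 w"
  shows "w n * \<bar>f n\<bar> \<le> ell1_norm w f"
  using weighted_sum_le_ell1_norm[OF assms, of "{n}"] by simp

lemma abs_le_ell1_norm:
  assumes "weight w" "f \<in> ell1 w" "1 \<le> n"
  shows "\<bar>f n\<bar> \<le> ell1_norm w f / w n"
  using weighted_term_le_ell1_norm[OF assms(1,2), of n] assms
  by (simp add: weight_def field_simps)

lemma ell1I_bounded:
  assumes "weight w" "f 0 = 0" and bound: "\<And>N. (\<Sum>n<N. w n * \<bar>f n\<bar>) \<le> C"
  shows "f \<in> ell1 w" "ell1_norm w f \<le> C"
proof -
  have nn: "0 \<le> w n * \<bar>f n\<bar>" for n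
    using assms(1,2) by (cases "n = 0") (auto simp: weight_def less_imp_le)
  have s: "summable (\<lambda>n. w n * \<bar>f n\<bar>)"
    using nn bound by (rule summableI_nonneg_bounded)
  show "f \<in> ell1 w" using s assms(2) by (simp add: ell1_def)
  show "ell1_norm w f \<le> C"
    unfolding ell1_norm_def using s bound by (rule suminf_le_const)
qed

lemma ell1_add:
  assumes "weight w" "f \<in> ell1 w" "g \<in> ell1 w"
  shows "(\<lambda>n. f n + g n) \<in> ell1 w"
    and "ell1_norm w (\<lambda>n. f n + g n) \<le> ell1_norm w f + ell1_norm w g"
proof -
  have bound: "(\<Sum>n<N. w n * \<bar>f n + g n\<bar>) \<le> ell1_norm w f + ell1_norm w g" for N
  proof -
    have "w n * \<bar>f n + g n\<bar> \<le> w n * \<bar>f n\<bar> + w n * \<bar>g n\<bar>" for n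
      using assms
      by (cases "n = 0")
        (auto simp: ell1_def weight_def simp flip: distrib_left
          intro!: mult_left_mono less_imp_le abs_triangle_ineq)
    then have "(\<Sum>n<N. w n * \<bar>f n + g n\<bar>) \<le> (\<Sum>n<N. w n * \<bar>f n\<bar>) + (\<Sum>n<N. w n * \<bar>g n\<bar>)"
      by (simp add: sum_mono flip: sum.distrib)
    also have "\<dots> \<le> ell1_norm w f + ell1_norm w g"
      by (intro add_mono weighted_sum_le_ell1_norm assms) auto
    finally show ?thesis .
  qed
  have z: "f 0 + g 0 = 0" using assms by (simp add: ell1_def)
  show "(\<lambda>n. f n + g n) \<in> ell1 w"
    using ell1I_bounded(1)[OF assms(1) z bound] .
  show "ell1_norm w (\<lambda>n. f n + g n) \<le> ell1_norm w f + ell1_norm w g"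
    using ell1I_bounded(2)[OF assms(1) z bound] .
qed

lemma ell1_scale:
  assumes "f \<in> ell1 w"
  shows "(\<lambda>n. c * f n) \<in> ell1 w"
    and "ell1_norm w (\<lambda>n. c * f n) = \<bar>c\<bar> * ell1_norm w f"
proof -
  have eq: "w n * \<bar>c * f n\<bar> = \<bar>c\<bar> * (w n * \<bar>f n\<bar>)" for n
    by (simp add: abs_mult)
  show "(\<lambda>n. c * f n) \<in> ell1 w"
    using assms by (simp add: ell1_def eq summable_mult)
  show "ell1_norm w (\<lambda>n. c * f n) = \<bar>c\<bar> * ell1_norm w f"
    unfolding ell1_norm_def eq using ell1_summable[OF assms] by (rule suminf_mult)
qed

lemma ell1_norm_minus: "ell1_norm w (\<lambda>n. f n - g n) = ell1_norm w (\<lambda>n. g n - f n)"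
  by (simp add: ell1_norm_def abs_minus_commute)

lemma ell1_diff:
  assumes "weight w" "f \<in> ell1 w" "g \<in> ell1 w"
  shows "(\<lambda>n. f n - g n) \<in> ell1 w"
    and "ell1_norm w (\<lambda>n. f n - g n) \<le> ell1_norm w f + ell1_norm w g"
  using ell1_add[OF assms(1,2) ell1_scale(1)[OF assms(3), of "-1"]]
    ell1_scale(2)[OF assms(3), of "-1"]
  by simp_all

lemma ell1_sum:
  assumes "weight w" "finite I" "\<And>i. i \<in> I \<Longrightarrow> F i \<in> ell1 w"
  shows "(\<lambda>n. \<Sum>i\<in>I. F i n) \<in> ell1 w"
    and "ell1_norm w (\<lambda>n. \<Sum>i\<in>I. F i n) \<le> (\<Sum>i\<in>I. ell1_norm w (F i))"
proof -
  have "(\<lambda>n. \<Sum>i\<in>I. F i n) \<in> ell1 w \<and>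
      ell1_norm w (\<lambda>n. \<Sum>i\<in>I. F i n) \<le> (\<Sum>i\<in>I. ell1_norm w (F i))"
    using assms(2,3)
  proof (induction I)
    case empty
    then show ?case by (simp add: ell1_def ell1_norm_def)
  next
    case (insert i I)
    then show ?case
      using ell1_add[OF assms(1), of "F i" "\<lambda>n. \<Sum>i\<in>I. F i n"] by force
  qed
  then show "(\<lambda>n. \<Sum>i\<in>I. F i n) \<in> ell1 w"
    and "ell1_norm w (\<lambda>n. \<Sum>i\<in>I. F i n) \<le> (\<Sum>i\<in>I. ell1_norm w (F i))"
    by auto
qed

lemma ell1_finite_support:
  assumes "f 0 = 0" "\<And>n. N < n \<Longrightarrow> f n = 0"
  shows "f \<in> ell1 w" "ell1_norm w f = (\<Sum>n = 1..N. w n * \<bar>f n\<bar>)"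
proof -
  have z: "w n * \<bar>f n\<bar> = 0" if "n \<notin> {1..N}" for n
    using that assms by (cases "n = 0") auto
  then have "(\<lambda>n. w n * \<bar>f n\<bar>) sums (\<Sum>n = 1..N. w n * \<bar>f n\<bar>)"
    by (intro sums_finite) auto
  then show "f \<in> ell1 w" "ell1_norm w f = (\<Sum>n = 1..N. w n * \<bar>f n\<bar>)"
    using assms(1) by (auto simp: ell1_def ell1_norm_def sums_iff)
qed

text \<open>Completeness of the weighted space, in the form needed for uniform boundedness. The sum
  is formed componentwise; on finitely many components the remainder is estimated by exchanging the
  finite sum with the series, and a bound uniform in their number bounds the norm.\<close>

lemma ell1_series_limit:
  assumes w: "weight w" and d: "\<And>i. d i \<in> ell1 w" and le: "\<And>i. ell1_norm w (d i) \<le> c i"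
    and c: "summable c"
  obtains y where "y \<in> ell1 w"
    and "\<And>n. ell1_norm w (\<lambda>k. y k - (\<Sum>i<n. d i k)) \<le> (\<Sum>i. c (i + n))"
proof -
  define y where "y k = (\<Sum>i. d i k)" for k
  have term_le: "w k * \<bar>d i k\<bar> \<le> c i" for i k
    using weighted_term_le_ell1_norm[OF w d] le order_trans by blast
  have summ: "summable (\<lambda>i. \<bar>d i k\<bar>)" for k
  proof (cases "k = 0")
    case True
    then show ?thesis using d by (simp add: ell1_def)
  next
    case False
    then have "0 < w k" using w by (simp add: weight_def)
    then have "norm \<bar>d i k\<bar> \<le> c i / w k" for i
      using term_le[of k i] by (simp add: field_simps)
    with summable_divide[OF c] show ?thesis by (rule summable_comparison_test')
  qed
  have y0: "y 0 = 0" using d by (simp add: y_def ell1_def)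
  have bound: "(\<Sum>k<K. w k * \<bar>y k - (\<Sum>i<n. d i k)\<bar>) \<le> (\<Sum>i. c (i + n))" for n K
  proof -
    have sn: "summable (\<lambda>i. \<bar>d (i + n) k\<bar>)" for k
      using summ[of k] by (subst summable_iff_shift)
    have "w k * \<bar>y k - (\<Sum>i<n. d i k)\<bar> \<le> (\<Sum>i. w k * \<bar>d (i + n) k\<bar>)" for k
    proof (cases "k = 0")
      case True
      then show ?thesis using d y0 by (simp add: ell1_def)
    next
      case False
      have "y k - (\<Sum>i<n. d i k) = (\<Sum>i. d (i + n) k)"
        unfolding y_def using suminf_split_initial_segment[of "\<lambda>i. d i k" n]
          summable_rabs_cancel[OF summ[of k]] by simp
      also have "\<bar>\<dots>\<bar> \<le> (\<Sum>i. \<bar>d (i + n) k\<bar>)" by (rule summable_rabs[OF sn])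
      finally have "w k * \<bar>y k - (\<Sum>i<n. d i k)\<bar> \<le> w k * (\<Sum>i. \<bar>d (i + n) k\<bar>)"
        using w False by (intro mult_left_mono) (auto simp: weight_def intro: less_imp_le)
      also have "\<dots> = (\<Sum>i. w k * \<bar>d (i + n) k\<bar>)" using suminf_mult[OF sn] by simp
      finally show ?thesis .
    qed
    then have "(\<Sum>k<K. w k * \<bar>y k - (\<Sum>i<n. d i k)\<bar>) \<le> (\<Sum>k<K. \<Sum>i. w k * \<bar>d (i + n) k\<bar>)"
      by (rule sum_mono)
    also have "\<dots> = (\<Sum>i. \<Sum>k<K. w k * \<bar>d (i + n) k\<bar>)"
      by (rule suminf_sum[symmetric]) (intro summable_mult sn)
    also have "\<dots> \<le> (\<Sum>i. c (i + n))"
    proof (rule suminf_le)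
      show "summable (\<lambda>i. \<Sum>k<K. w k * \<bar>d (i + n) k\<bar>)"
        by (intro summable_sum summable_mult sn)
      show "summable (\<lambda>i. c (i + n))" using c by (subst summable_iff_shift)
      show "(\<Sum>k<K. w k * \<bar>d (i + n) k\<bar>) \<le> c (i + n)" for i
        using weighted_sum_le_ell1_norm[OF w d, of "{..<K}"] le order_trans by blast
    qed
    finally show ?thesis .
  qed
  show ?thesis
  proof
    show "y \<in> ell1 w"
      by (rule ell1I_bounded(1)[of w y, OF w y0, of "suminf c"]) (use bound[where n = 0] in simp)
    show "ell1_norm w (\<lambda>k. y k - (\<Sum>i<n. d i k)) \<le> (\<Sum>i. c (i + n))" for n
    proof (rule ell1I_bounded(2)[OF w])
      show "y 0 - (\<Sum>i<n. d i 0) = 0" using y0 d by (simp add: ell1_def)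
    qed (rule bound)
  qed
qed

section \<open>Bounded operators\<close>

lemma bounded_operator_mem: "bounded_operator w T \<Longrightarrow> f \<in> ell1 w \<Longrightarrow> T f \<in> ell1 w"
  by (simp add: bounded_operator_def)

lemma bounded_operator_add:
  "bounded_operator w T \<Longrightarrow> f \<in> ell1 w \<Longrightarrow> g \<in> ell1 w \<Longrightarrow>
    T (\<lambda>n. f n + g n) = (\<lambda>n. T f n + T g n)"
  by (simp add: bounded_operator_def)

lemma bounded_operator_scale:
  "bounded_operator w T \<Longrightarrow> f \<in> ell1 w \<Longrightarrow> T (\<lambda>n. c * f n) = (\<lambda>n. c * T f n)"
  by (simp add: bounded_operator_def)

lemma bounded_operator_diff:
  "bounded_operator w T \<Longrightarrow> f \<in> ell1 w \<Longrightarrow> g \<in> ell1 w \<Longrightarrow>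
    T (\<lambda>n. f n - g n) = (\<lambda>n. T f n - T g n)"
  using bounded_operator_add[of w T f "\<lambda>n. -1 * g n"] bounded_operator_scale[of w T g "-1"]
    ell1_scale(1)[of g w "-1"]
  by simp

lemma bounded_operator_sum:
  assumes T: "bounded_operator w T" and w: "weight w"
    and "finite I" "\<And>i. i \<in> I \<Longrightarrow> F i \<in> ell1 w"
  shows "T (\<lambda>n. \<Sum>i\<in>I. c i * F i n) = (\<lambda>n. \<Sum>i\<in>I. c i * T (F i) n)"
  using assms(3,4)
proof (induction I)
  case empty
  have "(\<lambda>n. 0 :: real) \<in> ell1 w" by (simp add: ell1_def)
  then show ?case using bounded_operator_scale[OF T, of "\<lambda>n. 0" 0] by simp
next
  case (insert i I)
  then have "(\<lambda>n. \<Sum>i\<in>I. c i * F i n) \<in> ell1 w" "(\<lambda>n. c i * F i n) \<in> ell1 w"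
    by (intro ell1_sum(1)[OF w] ell1_scale(1); simp)+
  then show ?case
    using insert bounded_operator_add[OF T] bounded_operator_scale[OF T, of "F i" "c i"] by simp
qed

lemma bounded_operator_bound:
  assumes "weight w" "bounded_operator w T"
  obtains C where "0 \<le> C" "\<And>f. f \<in> ell1 w \<Longrightarrow> ell1_norm w (T f) \<le> C * ell1_norm w f"
proof -
  from assms(2) obtain C where C: "\<forall>f\<in>ell1 w. ell1_norm w (T f) \<le> C * ell1_norm w f"
    by (auto simp: bounded_operator_def)
  have "ell1_norm w (T f) \<le> \<bar>C\<bar> * ell1_norm w f" if "f \<in> ell1 w" for f
    using C that mult_right_mono[OF abs_ge_self ell1_norm_nonneg[OF assms(1) that], of C] by force
  then show ?thesis using that[of "\<bar>C\<bar>"] by simp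
qed

section \<open>Unit sequences and bounds for operators\<close>

definition unit_seq :: "nat \<Rightarrow> nat \<Rightarrow> real" where
  "unit_seq m = (\<lambda>n. if n = m then 1 else 0)"

lemma unit_seq_1: "unit_seq 1 = e1"
  by (simp add: unit_seq_def e1_def)

lemma unit_seq_ell1:
  assumes "1 \<le> m"
  shows "unit_seq m \<in> ell1 w" "ell1_norm w (unit_seq m) = w m"
proof -
  have *: "unit_seq m 0 = 0" "\<And>n. m < n \<Longrightarrow> unit_seq m n = 0"
    using assms by (auto simp: unit_seq_def)
  show "unit_seq m \<in> ell1 w" by (rule ell1_finite_support(1)[of "unit_seq m", OF *])
  have "ell1_norm w (unit_seq m) = (\<Sum>n = 1..m. w n * \<bar>unit_seq m n\<bar>)"
    by (rule ell1_finite_support(2)[of "unit_seq m", OF *])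
  also have "\<dots> = (\<Sum>n = 1..m. if n = m then w m else 0)"
    by (rule sum.cong) (auto simp: unit_seq_def)
  finally show "ell1_norm w (unit_seq m) = w m" using assms by simp
qed

lemma unit_seq_expansion:
  "(\<Sum>m = 1..N. u m * unit_seq m n) = (if n \<in> {1..N} then u n else 0)"
proof -
  have "(\<Sum>m = 1..N. u m * unit_seq m n) = (\<Sum>m = 1..N. if m = n then u n else 0)"
    by (rule sum.cong) (auto simp: unit_seq_def)
  then show ?thesis by simp
qed

lemma sum_unit_seq: "finite K \<Longrightarrow> (\<Sum>k\<in>K. v k * unit_seq m k) = (if m \<in> K then v m else 0)"
  by (simp add: unit_seq_def if_distrib cong: if_cong)

text \<open>The triangle inequality for the expansion of \<open>u\<close> in unit sequences.
  Linearity gives it for finite truncations; boundedness of \<open>T\<close> makes the image of the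
  remainder vanish in the limit. The bounds \<open>c m\<close> are not tied to \<open>w m\<close>,
  so that dominated convergence can be applied to them later.\<close>

lemma bounded_operator_norm_le_suminf:
  assumes w: "weight w" and T: "bounded_operator w T" and u: "u \<in> ell1 w"
    and c: "\<And>m. 1 \<le> m \<Longrightarrow> ell1_norm w (T (unit_seq m)) \<le> c m"
    and s: "summable (\<lambda>m. \<bar>u m\<bar> * c m)"
  shows "ell1_norm w (T u) \<le> (\<Sum>m. \<bar>u m\<bar> * c m)"
proof -
  obtain C where C: "0 \<le> C" "\<And>f. f \<in> ell1 w \<Longrightarrow> ell1_norm w (T f) \<le> C * ell1_norm w f"
    using bounded_operator_bound[OF w T] by blast
  have Tu: "T (unit_seq m) \<in> ell1 w" if "1 \<le> m" for m
    using bounded_operator_mem[OF T] unit_seq_ell1(1)[OF that] .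
  have cnn: "0 \<le> \<bar>u m\<bar> * c m" for m
  proof (cases "m = 0")
    case False
    then have "0 \<le> c m" using c[of m] ell1_norm_nonneg[OF w Tu[of m]] by force
    then show ?thesis by simp
  qed (use u in \<open>simp add: ell1_def\<close>)
  have le: "ell1_norm w (T u) \<le>
      (\<Sum>m. \<bar>u m\<bar> * c m) + C * (ell1_norm w u - (\<Sum>n<Suc N. w n * \<bar>u n\<bar>))" for N
  proof -
    \<comment> \<open>The truncation to \<open>{1..N}\<close> is written in unit sequences so that
      finite linearity applies. The norm of the remainder \<open>r\<close> is exactly the tail of
      the norm of \<open>u\<close>.\<close>
    define v where "v n = (\<Sum>m = 1..N. u m * unit_seq m n)" for n
    have v: "v n = (if n \<in> {1..N} then u n else 0)" for n
      unfolding v_def by (rule unit_seq_expansion)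
    have v_mem: "v \<in> ell1 w" by (rule ell1_finite_support(1)[of _ N]) (auto simp: v)
    define r where "r n = u n - v n" for n
    have r_mem: "r \<in> ell1 w" unfolding r_def by (rule ell1_diff(1)[OF w u v_mem])
    have "ell1_norm w r = (\<Sum>n. w (n + Suc N) * \<bar>r (n + Suc N)\<bar>) + (\<Sum>n<Suc N. w n * \<bar>r n\<bar>)"
      unfolding ell1_norm_def
      using suminf_split_initial_segment[OF ell1_summable[OF r_mem], of "Suc N"] by simp
    also have "(\<Sum>n<Suc N. w n * \<bar>r n\<bar>) = 0"
    proof (intro sum.neutral ballI)
      show "w n * \<bar>r n\<bar> = 0" if "n \<in> {..<Suc N}" for n
        using that u by (cases "n = 0") (auto simp: r_def v ell1_def)
    qed
    also have "(\<Sum>n. w (n + Suc N) * \<bar>r (n + Suc N)\<bar>) = (\<Sum>n. w (n + Suc N) * \<bar>u (n + Suc N)\<bar>)"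
      by (simp add: r_def v)
    also have "\<dots> = ell1_norm w u - (\<Sum>n<Suc N. w n * \<bar>u n\<bar>)"
      unfolding ell1_norm_def
      using suminf_split_initial_segment[OF ell1_summable[OF u], of "Suc N"] by simp
    finally have rn: "ell1_norm w r = ell1_norm w u - (\<Sum>n<Suc N. w n * \<bar>u n\<bar>)" by simp
    have "T v = (\<lambda>n. \<Sum>m = 1..N. u m * T (unit_seq m) n)"
      unfolding v_def by (rule bounded_operator_sum[OF T w]) (auto intro: unit_seq_ell1)
    then have "ell1_norm w (T v) \<le> (\<Sum>m = 1..N. ell1_norm w (\<lambda>n. u m * T (unit_seq m) n))"
      using ell1_sum(2)[OF w, of "{1..N}" "\<lambda>m n. u m * T (unit_seq m) n"] Tu
      by (auto intro: ell1_scale)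
    also have "\<dots> \<le> (\<Sum>m = 1..N. \<bar>u m\<bar> * c m)"
      using ell1_scale(2)[OF Tu] c by (intro sum_mono) (auto intro: mult_left_mono)
    also have "\<dots> \<le> (\<Sum>m. \<bar>u m\<bar> * c m)"
      using s cnn by (intro sum_le_suminf) auto
    finally have Tv: "ell1_norm w (T v) \<le> (\<Sum>m. \<bar>u m\<bar> * c m)" .
    have "T u = (\<lambda>n. T v n + T r n)"
      using bounded_operator_add[OF T v_mem r_mem] by (simp add: r_def)
    then have "ell1_norm w (T u) \<le> ell1_norm w (T v) + ell1_norm w (T r)"
      using ell1_add(2)[OF w] bounded_operator_mem[OF T] v_mem r_mem by simp
    then show ?thesis using Tv C(2)[OF r_mem] rn by simp
  qed
  have "(\<lambda>N. \<Sum>n<Suc N. w n * \<bar>u n\<bar>) \<longlonglongrightarrow> ell1_norm w u"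
    unfolding ell1_norm_def using summable_LIMSEQ[OF ell1_summable[OF u]] by (rule LIMSEQ_Suc)
  then have "(\<lambda>N. (\<Sum>m. \<bar>u m\<bar> * c m) + C * (ell1_norm w u - (\<Sum>n<Suc N. w n * \<bar>u n\<bar>)))
      \<longlonglongrightarrow> (\<Sum>m. \<bar>u m\<bar> * c m) + C * (ell1_norm w u - ell1_norm w u)"
    by (intro tendsto_intros)
  then show ?thesis using le by (intro LIMSEQ_le_const) auto
qed

lemma bounded_operator_norm_le:
  assumes "weight w" "bounded_operator w T" "u \<in> ell1 w"
    and "\<And>m. 1 \<le> m \<Longrightarrow> ell1_norm w (T (unit_seq m)) \<le> C * w m"
  shows "ell1_norm w (T u) \<le> C * ell1_norm w u"
proof -
  have eq: "\<bar>u m\<bar> * (C * w m) = C * (w m * \<bar>u m\<bar>)" for m by simp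
  have "ell1_norm w (T u) \<le> (\<Sum>m. \<bar>u m\<bar> * (C * w m))"
    using assms ell1_summable[OF assms(3)]
    by (intro bounded_operator_norm_le_suminf) (auto simp: eq intro: summable_mult)
  then show ?thesis
    unfolding eq ell1_norm_def using suminf_mult[OF ell1_summable[OF assms(3)], of C] by simp
qed

text \<open>Sokal's proof of uniform boundedness: moving by \<open>\<plusminus>z\<close>, one of the two signs makes the image at
  least as large as the image of \<open>z\<close>; geometrically shrinking moves then converge to a point at
  which the operators are unbounded.\<close>

lemma ell1_uniform_boundedness:
  assumes w: "weight w" and T: "\<And>k::nat. bounded_operator w (T k)"
    and pointwise: "\<And>f. f \<in> ell1 w \<Longrightarrow> \<exists>C. \<forall>k. ell1_norm w (T k f) \<le> C"
  shows "\<exists>C. \<forall>k. \<forall>f\<in>ell1 w. ell1_norm w (T k f) \<le> C * ell1_norm w f"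
proof (rule ccontr)
  assume unbounded: "\<not> ?thesis"
  \<comment> \<open>\<open>R k\<close> is the operator norm of \<open>T k\<close>, computed as a
    supremum over normalised unit sequences.\<close>
  define R where "R k = (SUP m\<in>{1..}. ell1_norm w (T k (unit_seq m)) / w m)" for k
  have wpos: "0 < w m" if "1 \<le> m" for m using w that by (simp add: weight_def)
  have bdd: "bdd_above ((\<lambda>m. ell1_norm w (T k (unit_seq m)) / w m) ` {1..})" for k
  proof -
    obtain C where "\<And>f. f \<in> ell1 w \<Longrightarrow> ell1_norm w (T k f) \<le> C * ell1_norm w f"
      using bounded_operator_bound[OF w T[of k]] by blast
    then have "ell1_norm w (T k (unit_seq m)) / w m \<le> C" if "1 \<le> m" for m
      using unit_seq_ell1[OF that, of w] wpos[OF that] by (metis pos_divide_le_eq)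
    then show ?thesis by (intro bdd_aboveI2[where M = C]) simp
  qed
  have R_bound: "ell1_norm w (T k f) \<le> R k * ell1_norm w f" if "f \<in> ell1 w" for k f
  proof (rule bounded_operator_norm_le[OF w T that])
    show "ell1_norm w (T k (unit_seq m)) \<le> R k * w m" if "1 \<le> m" for m
      using cSUP_upper[OF _ bdd, of m k] that wpos[OF that] by (simp add: R_def field_simps)
  qed
  have R_large: "\<exists>k. C < R k" for C
  proof (rule ccontr)
    assume "\<nexists>k. C < R k"
    then have "ell1_norm w (T k f) \<le> C * ell1_norm w f" if "f \<in> ell1 w" for k f
      using R_bound[OF that, of k] mult_right_mono[OF _ ell1_norm_nonneg[OF w that], of "R k" C]
      by (meson linorder_not_le order_trans)
    with unbounded show False by blast
  qed
  \<comment> \<open>The growth beats the shrinking of the moves: an image of size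
    \<open>3 / 4 * R\<close> is gained and at most \<open>R / 2\<close> is lost later, both scaled
    by \<open>(1 / 3) ^ n\<close>. The remaining quarter exceeds \<open>n\<close>.\<close>
  have "\<exists>k. 4 * real n * 3 ^ n < R k" for n by (rule R_large)
  then obtain \<kappa> where \<kappa>: "4 * real n * 3 ^ n < R (\<kappa> n)" for n by metis
  have R_pos: "0 < R (\<kappa> n)" for n using \<kappa>[of n] by (rule le_less_trans[rotated]) simp
  \<comment> \<open>The supremum need not be attained. The fraction 3/4 exceeds the 1/2 that the
    later moves can undo.\<close>
  have "\<exists>m\<ge>1. 3 / 4 * R (\<kappa> n) \<le> ell1_norm w (T (\<kappa> n) (unit_seq m)) / w m" for n
  proof (rule ccontr)
    assume "\<not> ?thesis"
    then have "R (\<kappa> n) \<le> 3 / 4 * R (\<kappa> n)"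
      unfolding R_def[of "\<kappa> n"] by (intro cSUP_least) auto
    then show False using R_pos[of n] by simp
  qed
  then obtain \<mu> where \<mu>: "1 \<le> \<mu> n"
    "3 / 4 * R (\<kappa> n) \<le> ell1_norm w (T (\<kappa> n) (unit_seq (\<mu> n))) / w (\<mu> n)" for n
    by metis
  define z where "z n j = (1 / 3) ^ n / w (\<mu> n) * unit_seq (\<mu> n) j" for n j
  have z_mem: "z n \<in> ell1 w" and z_norm: "ell1_norm w (z n) = (1 / 3) ^ n" for n
    unfolding z_def using ell1_scale[OF unit_seq_ell1(1)[OF \<mu>(1)[of n]], where c = "(1 / 3) ^ n / w (\<mu> n)"]
      unit_seq_ell1(2)[OF \<mu>(1)[of n], of w] wpos[OF \<mu>(1)[of n]]
    by (auto simp: abs_of_pos)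
  have Tz: "(1 / 3) ^ n * (3 / 4 * R (\<kappa> n)) \<le> ell1_norm w (T (\<kappa> n) (z n))" for n
  proof -
    have "T (\<kappa> n) (z n) = (\<lambda>j. (1 / 3) ^ n / w (\<mu> n) * T (\<kappa> n) (unit_seq (\<mu> n)) j)"
      unfolding z_def by (rule bounded_operator_scale[OF T unit_seq_ell1(1)[OF \<mu>(1)]])
    moreover have "T (\<kappa> n) (unit_seq (\<mu> n)) \<in> ell1 w"
      by (rule bounded_operator_mem[OF T unit_seq_ell1(1)[OF \<mu>(1)]])
    ultimately have "ell1_norm w (T (\<kappa> n) (z n)) =
        \<bar>(1 / 3) ^ n / w (\<mu> n)\<bar> * ell1_norm w (T (\<kappa> n) (unit_seq (\<mu> n)))"
      by (simp only: ell1_scale(2))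
    then have "ell1_norm w (T (\<kappa> n) (z n)) =
        (1 / 3) ^ n * (ell1_norm w (T (\<kappa> n) (unit_seq (\<mu> n))) / w (\<mu> n))"
      using wpos[OF \<mu>(1)[of n]] by (simp add: abs_of_pos)
    then show ?thesis using \<mu>(2)[of n] by (simp only:) (rule mult_left_mono, auto)
  qed
  have Tz_mem: "T (\<kappa> n) (z n) \<in> ell1 w" for n by (rule bounded_operator_mem[OF T z_mem])
  have "\<exists>y. \<forall>n. y n \<in> ell1 w \<and>
      (ell1_norm w (\<lambda>j. y (Suc n) j - y n j) \<le> (1 / 3) ^ n \<and>
       (1 / 3) ^ n * (3 / 4 * R (\<kappa> n)) \<le> ell1_norm w (T (\<kappa> n) (y (Suc n))))"
  proof (rule dependent_nat_choice)
    show "\<exists>y. y \<in> ell1 w" using z_mem by blast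
  next
    fix y n
    assume y: "y \<in> ell1 w"
    define p where "p j = y j + z n j" for j
    define q where "q j = y j - z n j" for j
    have p: "p \<in> ell1 w" unfolding p_def using ell1_add(1)[OF w y z_mem] .
    have q: "q \<in> ell1 w" unfolding q_def using ell1_diff(1)[OF w y z_mem] .
    have "(\<lambda>j. 2 * T (\<kappa> n) (z n) j) = T (\<kappa> n) (\<lambda>j. p j - q j)"
      using bounded_operator_scale[OF T[of "\<kappa> n"] z_mem[of n], of 2] by (simp add: p_def q_def)
    also have "\<dots> = (\<lambda>j. T (\<kappa> n) p j - T (\<kappa> n) q j)" by (rule bounded_operator_diff[OF T p q])
    finally have "2 * ell1_norm w (T (\<kappa> n) (z n)) \<le>
        ell1_norm w (T (\<kappa> n) p) + ell1_norm w (T (\<kappa> n) q)"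
      using ell1_scale(2)[OF Tz_mem[of n], of 2]
        ell1_diff(2)[OF w bounded_operator_mem[OF T[of "\<kappa> n"] p] bounded_operator_mem[OF T[of "\<kappa> n"] q]]
      by simp
    then have "(1 / 3) ^ n * (3 / 4 * R (\<kappa> n)) \<le> ell1_norm w (T (\<kappa> n) p) \<or>
        (1 / 3) ^ n * (3 / 4 * R (\<kappa> n)) \<le> ell1_norm w (T (\<kappa> n) q)"
      using Tz[of n] by linarith
    moreover have "ell1_norm w (\<lambda>j. p j - y j) \<le> (1 / 3) ^ n"
      using z_norm[of n] by (simp add: p_def)
    moreover have "ell1_norm w (\<lambda>j. q j - y j) \<le> (1 / 3) ^ n"
      using z_norm[of n] by (simp add: q_def ell1_norm_def)
    ultimately show "\<exists>y'. y' \<in> ell1 w \<and> (ell1_norm w (\<lambda>j. y' j - y j) \<le> (1 / 3) ^ n \<and>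
        (1 / 3) ^ n * (3 / 4 * R (\<kappa> n)) \<le> ell1_norm w (T (\<kappa> n) y'))"
      using p q by blast
  qed
  then obtain y where y: "\<And>n. y n \<in> ell1 w"
    and y_step: "\<And>n. ell1_norm w (\<lambda>j. y (Suc n) j - y n j) \<le> (1 / 3) ^ n"
    and Ty: "\<And>n. (1 / 3) ^ n * (3 / 4 * R (\<kappa> n)) \<le> ell1_norm w (T (\<kappa> n) (y (Suc n)))"
    by blast
  have geom: "summable (\<lambda>n. (1 / 3 :: real) ^ n)" by (simp add: summable_geometric)
  obtain Y where Y: "Y \<in> ell1 w"
    and lim: "\<And>n. ell1_norm w (\<lambda>j. Y j - (\<Sum>i<n. y (Suc i) j - y i j)) \<le> (\<Sum>i. (1 / 3) ^ (i + n))"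
    using ell1_series_limit[OF w ell1_diff(1)[OF w y y] y_step geom] by blast
  define X where "X j = Y j + y 0 j" for j
  have X: "X \<in> ell1 w" unfolding X_def by (rule ell1_add(1)[OF w Y y])
  \<comment> \<open>The moves still to come after \<open>y (Suc n)\<close> have total length at most
    the sum of \<open>(1 / 3) ^ i\<close> over \<open>i > n\<close>, which is half of
    \<open>(1 / 3) ^ n\<close>.\<close>
  have X_near: "ell1_norm w (\<lambda>j. y (Suc n) j - X j) \<le> (1 / 3) ^ n / 2" for n
  proof -
    have "(\<Sum>i. (1 / 3 :: real) ^ (i + Suc n)) = (\<Sum>i. (1 / 3) ^ i) * (1 / 3) ^ Suc n"
      unfolding power_add by (rule suminf_mult2[OF geom, symmetric])
    also have "\<dots> = (1 / 3) ^ n / 2" by (simp add: suminf_geometric)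
    finally have "(\<Sum>i. (1 / 3 :: real) ^ (i + Suc n)) = (1 / 3) ^ n / 2" .
    moreover have "X j - y (Suc n) j = Y j - (\<Sum>i<Suc n. y (Suc i) j - y i j)" for j
      using sum_lessThan_telescope[of "\<lambda>i. y i j" "Suc n"] unfolding X_def by linarith
    ultimately show ?thesis
      using lim[of "Suc n"] unfolding ell1_norm_minus[of w "y (Suc n)"] by (simp only:)
  qed
  have large: "real n < ell1_norm w (T (\<kappa> n) X)" for n
  proof -
    define r where "r j = y (Suc n) j - X j" for j
    have r: "r \<in> ell1 w" unfolding r_def by (rule ell1_diff(1)[OF w y X])
    have "T (\<kappa> n) (y (Suc n)) = (\<lambda>j. T (\<kappa> n) X j + T (\<kappa> n) r j)"
      using bounded_operator_add[OF T X r] by (simp add: r_def)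
    then have "ell1_norm w (T (\<kappa> n) (y (Suc n))) \<le>
        ell1_norm w (T (\<kappa> n) X) + ell1_norm w (T (\<kappa> n) r)"
      using ell1_add(2)[OF w bounded_operator_mem[OF T X] bounded_operator_mem[OF T r]] by simp
    moreover have "ell1_norm w (T (\<kappa> n) r) \<le> R (\<kappa> n) * ((1 / 3) ^ n / 2)"
      using R_bound[OF r, of "\<kappa> n"] X_near[of n] R_pos[of n] unfolding r_def
      by (meson less_imp_le mult_left_mono order_trans)
    moreover have "real n < (1 / 3) ^ n * R (\<kappa> n) / 4"
      using \<kappa>[of n] by (simp add: power_divide field_simps)
    ultimately show ?thesis using Ty[of n] by (simp add: algebra_simps)
  qed
  from pointwise[OF X] obtain C where "\<And>k. ell1_norm w (T k X) \<le> C" by blast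
  moreover obtain n where "C < real n" using reals_Archimedean2 by blast
  ultimately show False using large[of n] by (meson less_le_trans less_irrefl order.strict_trans)
qed

section \<open>Orbits of a strongly continuous semigroup\<close>

lemma C0_semigroup_bounded: "C0_semigroup w S \<Longrightarrow> 0 \<le> t \<Longrightarrow> bounded_operator w (S t)"
  by (simp add: C0_semigroup_def)

text \<open>Otherwise there are times \<open>\<tau> n\<close> tending to 0 at which the operator
  norm exceeds \<open>n\<close>. Strong continuity at 0 bounds each orbit along these times, so
  uniform boundedness bounds the operators, a contradiction.\<close>

lemma C0_semigroup_bounded_near_zero:
  assumes w: "weight w" and S: "C0_semigroup w S"
  obtains \<delta> C where "0 < \<delta>" "0 \<le> C"
    "\<And>t f. 0 \<le> t \<Longrightarrow> t \<le> \<delta> \<Longrightarrow> f \<in> ell1 w \<Longrightarrow> ell1_norm w (S t f) \<le> C * ell1_norm w f"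
proof -
  have "\<exists>\<delta>>0. \<exists>C\<ge>0. \<forall>t. 0 \<le> t \<and> t \<le> \<delta> \<longrightarrow> (\<forall>f\<in>ell1 w. ell1_norm w (S t f) \<le> C * ell1_norm w f)"
  proof (rule ccontr)
    assume neg: "\<not> ?thesis"
    have "\<exists>t f. 0 \<le> t \<and> t \<le> 1 / Suc n \<and> f \<in> ell1 w \<and> real n * ell1_norm w f < ell1_norm w (S t f)"
      for n
      using neg[simplified, rule_format, of "1 / Suc n" "real n"] by (auto simp: not_le)
    then obtain \<tau> \<phi> where \<tau>: "\<And>n. 0 \<le> \<tau> n" "\<And>n. \<tau> n \<le> 1 / Suc n"
      and \<phi>: "\<And>n. \<phi> n \<in> ell1 w" "\<And>n. real n * ell1_norm w (\<phi> n) < ell1_norm w (S (\<tau> n) (\<phi> n))"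
      by metis
    have "\<exists>C. \<forall>n. ell1_norm w (S (\<tau> n) f) \<le> C" if f: "f \<in> ell1 w" for f
    proof -
      have "((\<lambda>t. ell1_norm w (\<lambda>n. S t f n - f n)) \<longlongrightarrow> 0) (at_right 0)"
        using S f by (simp add: C0_semigroup_def)
      then have "\<forall>\<^sub>F t in at_right 0. ell1_norm w (\<lambda>n. S t f n - f n) < 1"
        by (rule order_tendstoD) simp
      then obtain b where b: "0 < b" "\<And>t. 0 < t \<Longrightarrow> t < b \<Longrightarrow> ell1_norm w (\<lambda>n. S t f n - f n) < 1"
        by (auto simp: eventually_at_right_field)
      have small: "ell1_norm w (S t f) \<le> ell1_norm w f + 1" if "0 \<le> t" "t < b" for t
      proof (cases "t = 0")
        case True
        then show ?thesis using S f by (simp add: C0_semigroup_def)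
      next
        case False
        have "S t f \<in> ell1 w"
          using bounded_operator_mem[OF C0_semigroup_bounded[OF S that(1)] f] .
        from ell1_add(2)[OF w f ell1_diff(1)[OF w this f]] show ?thesis
          using b(2)[of t] that False by simp
      qed
      \<comment> \<open>From index \<open>N\<close> on the times fall where the orbit stays within
        distance 1 of \<open>f\<close>; the finitely many earlier norms are absorbed into
        \<open>C\<close> by adding them up.\<close>
      obtain N where N: "1 / Suc N < b" using b(1) nat_approx_posE by blast
      define C where "C = ell1_norm w f + 1 + (\<Sum>n<N. ell1_norm w (S (\<tau> n) f))"
      have nn: "0 \<le> ell1_norm w (S (\<tau> n) f)" for n
        using ell1_norm_nonneg[OF w bounded_operator_mem[OF C0_semigroup_bounded[OF S \<tau>(1)] f]] .
      have "ell1_norm w (S (\<tau> n) f) \<le> C" for n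
      proof (cases "n < N")
        case True
        then have "ell1_norm w (S (\<tau> n) f) \<le> (\<Sum>n<N. ell1_norm w (S (\<tau> n) f))"
          using nn by (intro member_le_sum) auto
        then show ?thesis using ell1_norm_nonneg[OF w f] by (simp add: C_def)
      next
        case False
        then have "1 / real (Suc n) \<le> 1 / Suc N" by (intro divide_left_mono) auto
        then have "\<tau> n < b" using \<tau>(2)[of n] N by linarith
        then have "ell1_norm w (S (\<tau> n) f) \<le> ell1_norm w f + 1" by (rule small[OF \<tau>(1)])
        also have "\<dots> \<le> C" unfolding C_def using nn by (simp add: sum_nonneg)
        finally show ?thesis .
      qed
      then show ?thesis by blast
    qed
    then obtain C where C: "\<And>n f. f \<in> ell1 w \<Longrightarrow> ell1_norm w (S (\<tau> n) f) \<le> C * ell1_norm w f"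
      using ell1_uniform_boundedness[of w "\<lambda>n. S (\<tau> n)", OF w C0_semigroup_bounded[OF S \<tau>(1)]]
      by blast
    obtain n where "C < real n" using reals_Archimedean2 by blast
    then have "C * ell1_norm w (\<phi> n) \<le> real n * ell1_norm w (\<phi> n)"
      using ell1_norm_nonneg[OF w \<phi>(1)] by (intro mult_right_mono) auto
    then show False using C[OF \<phi>(1), of n] \<phi>(2)[of n] by (meson leD order_trans)
  qed
  then show ?thesis using that by blast
qed

text \<open>Left difference quotients at \<open>t\<close> start from times \<open>r\<close> just
  before \<open>t\<close>. If \<open>t\<close> exceeds \<open>\<delta>\<close>, every such
  \<open>r\<close> is reached from the single time \<open>t - \<delta>\<close> by a step of length
  at most \<open>\<delta>\<close>, so the bound near 0 is multiplied by one fixed constant.\<close>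

lemma C0_semigroup_bounded_left:
  assumes w: "weight w" and S: "C0_semigroup w S"
  obtains \<delta> C where "0 < \<delta>" "0 \<le> C"
    "\<And>r f. 0 \<le> r \<Longrightarrow> t - \<delta> \<le> r \<Longrightarrow> r \<le> t \<Longrightarrow> f \<in> ell1 w \<Longrightarrow>
      ell1_norm w (S r f) \<le> C * ell1_norm w f"
proof -
  obtain \<delta> C where \<delta>: "0 < \<delta>" and C: "0 \<le> C"
    "\<And>t f. 0 \<le> t \<Longrightarrow> t \<le> \<delta> \<Longrightarrow> f \<in> ell1 w \<Longrightarrow> ell1_norm w (S t f) \<le> C * ell1_norm w f"
    using C0_semigroup_bounded_near_zero[OF w S] by blast
  show ?thesis
  proof (cases "t \<le> \<delta>")
    case True
    then show ?thesis using that[OF \<delta> C(1)] C(2) by (meson order_trans)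
  next
    case False
    then have t: "0 \<le> t - \<delta>" by simp
    obtain D where D: "0 \<le> D" "\<And>f. f \<in> ell1 w \<Longrightarrow> ell1_norm w (S (t - \<delta>) f) \<le> D * ell1_norm w f"
      using bounded_operator_bound[OF w C0_semigroup_bounded[OF S t]] by blast
    have "ell1_norm w (S r f) \<le> D * C * ell1_norm w f"
      if "0 \<le> r" "t - \<delta> \<le> r" "r \<le> t" "f \<in> ell1 w" for r f
    proof -
      have h: "0 \<le> r - (t - \<delta>)" "r - (t - \<delta>) \<le> \<delta>" using that by auto
      have "S ((t - \<delta>) + (r - (t - \<delta>))) f = S (t - \<delta>) (S (r - (t - \<delta>)) f)"
        using S t h(1) that(4) unfolding C0_semigroup_def by blast
      moreover have "(t - \<delta>) + (r - (t - \<delta>)) = r" by simp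
      ultimately have "S r f = S (t - \<delta>) (S (r - (t - \<delta>)) f)" by (simp only:)
      then have "ell1_norm w (S r f) \<le> D * ell1_norm w (S (r - (t - \<delta>)) f)"
        using D(2)[OF bounded_operator_mem[OF C0_semigroup_bounded[OF S h(1)] that(4)]] by simp
      also have "\<dots> \<le> D * (C * ell1_norm w f)"
        using C(2)[OF h that(4)] D(1) by (rule mult_left_mono)
      finally show ?thesis by (simp add: mult.assoc)
    qed
    with \<delta> C(1) D(1) show ?thesis by (intro that[of \<delta> "D * C"]) auto
  qed
qed

text \<open>By the semigroup law a difference quotient at \<open>t\<close> is \<open>S r\<close>
  applied to one at 0, and the latter converges to \<open>g\<close>. To the right
  \<open>r = t\<close> is fixed; to the left \<open>r\<close> moves with \<open>s\<close>, which
  calls for the local bound and for strong continuity of the orbit of \<open>g\<close>.\<close>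

lemma generator_orbit_derivative:
  assumes w: "weight w" and S: "C0_semigroup w S" and fg: "(f, g) \<in> generator w S"
    and t: "0 \<le> t" and k: "1 \<le> k"
  shows "((\<lambda>t. S t f k) has_real_derivative S t g k) (at t within {0..})"
proof -
  have f: "f \<in> ell1 w" and g: "g \<in> ell1 w" using fg by (auto simp: generator_def)
  have wk: "0 < w k" using w k by (simp add: weight_def)
  obtain \<delta> C where \<delta>: "0 < \<delta>" and C: "0 \<le> C"
    "\<And>r f. 0 \<le> r \<Longrightarrow> t - \<delta> \<le> r \<Longrightarrow> r \<le> t \<Longrightarrow> f \<in> ell1 w \<Longrightarrow>
      ell1_norm w (S r f) \<le> C * ell1_norm w f"
    using C0_semigroup_bounded_left[OF w S, of t] by blast
  have coord: "\<bar>S r h k\<bar> \<le> C / w k * ell1_norm w h"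
    if "0 \<le> r" "t - \<delta> \<le> r" "r \<le> t" "h \<in> ell1 w" for r h
  proof -
    have "S r h \<in> ell1 w"
      using bounded_operator_mem[OF C0_semigroup_bounded[OF S that(1)] that(4)] .
    then have "\<bar>S r h k\<bar> \<le> ell1_norm w (S r h) / w k" by (rule abs_le_ell1_norm[OF w _ k])
    also have "\<dots> \<le> C * ell1_norm w h / w k"
      using C(2)[OF that] wk by (intro divide_right_mono) auto
    finally show ?thesis by simp
  qed
  define err where "err h = ell1_norm w (\<lambda>n. (S h f n - f n) / h - g n)" for h
  define osc where "osc h = ell1_norm w (\<lambda>n. S h g n - g n)" for h
  have err: "(err \<longlongrightarrow> 0) (at_right 0)" using fg by (simp add: generator_def err_def[abs_def])
  have osc: "(osc \<longlongrightarrow> 0) (at_right 0)" using S g by (simp add: C0_semigroup_def osc_def[abs_def])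
  \<comment> \<open>From either side the distance of \<open>s\<close> to \<open>t\<close> tends to 0
    through positive values, so it can be substituted into the right-hand limits at 0.\<close>
  have "((\<lambda>s. \<bar>s - t\<bar>) \<longlongrightarrow> \<bar>t - t\<bar>) (at t within {0..})" by (intro tendsto_intros)
  then have dist: "filterlim (\<lambda>s. \<bar>s - t\<bar>) (at_right 0) (at t within {0..})"
    by (auto simp: filterlim_at eventually_at_filter)
  have est: "\<bar>(S s f k - S t f k) / (s - t) - S t g k\<bar> \<le> C / w k * (err \<bar>s - t\<bar> + osc \<bar>s - t\<bar>)"
    if s: "0 \<le> s" "s \<noteq> t" "\<bar>s - t\<bar> < \<delta>" for s
  proof -
    define h where "h = \<bar>s - t\<bar>"
    \<comment> \<open>The earlier of the two times is the base point, so both sides share one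
      formula for the quotient.\<close>
    define r where "r = min s t"
    have h: "0 < h" and r: "0 \<le> r" "t - \<delta> \<le> r" "r \<le> t" using s t by (auto simp: h_def r_def)
    note Sr = C0_semigroup_bounded[OF S r(1)]
    have Sh: "S h x \<in> ell1 w" if "x \<in> ell1 w" for x
      using bounded_operator_mem[OF C0_semigroup_bounded[OF S] that] h by simp
    have split: "S (r + h) x = S r (S h x)" if "x \<in> ell1 w" for x
      using S r(1) h that by (simp add: C0_semigroup_def)
    have incr: "S r (\<lambda>n. S h x n - x n) k = S (r + h) x k - S r x k" if "x \<in> ell1 w" for x
      using bounded_operator_diff[OF Sr Sh[OF that] that] split[OF that] by simp
    have quot: "(S s f k - S t f k) / (s - t) = (S (r + h) f k - S r f k) / h"
    proof (cases "s < t")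
      case True
      then have "s = r" "t = r + h" by (auto simp: r_def h_def)
      then show ?thesis using h by (simp only:) (simp add: field_simps)
    next
      case False
      then have "t = r" "s = r + h" by (auto simp: r_def h_def)
      then show ?thesis by (simp only:) simp
    qed
    define d where "d n = (1 / h) * (S h f n - f n)" for n
    have df: "(\<lambda>n. S h f n - f n) \<in> ell1 w" by (rule ell1_diff(1)[OF w Sh[OF f] f])
    then have d: "d \<in> ell1 w" unfolding d_def by (rule ell1_scale(1))
    have "S r d k = (S (r + h) f k - S r f k) / h"
      unfolding d_def bounded_operator_scale[OF Sr df] incr[OF f] by simp
    then have "S r (\<lambda>n. d n - g n) k = (S s f k - S t f k) / (s - t) - S r g k"
      using bounded_operator_diff[OF Sr d g] quot by simp
    moreover have "err h = ell1_norm w (\<lambda>n. d n - g n)" by (simp add: err_def d_def)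
    ultimately have 1: "\<bar>(S s f k - S t f k) / (s - t) - S r g k\<bar> \<le> C / w k * err h"
      using coord[OF r ell1_diff(1)[OF w d g]] by simp
    have dg: "(\<lambda>n. S h g n - g n) \<in> ell1 w" by (rule ell1_diff(1)[OF w Sh[OF g] g])
    \<comment> \<open>Replacing \<open>S r g\<close> by \<open>S t g\<close> costs the oscillation
      of the orbit of \<open>g\<close> when \<open>s < t\<close>, and nothing otherwise.\<close>
    have 2: "\<bar>S t g k - S r g k\<bar> \<le> C / w k * osc h"
    proof (cases "s < t")
      case True
      then have "r + h = t" by (auto simp: r_def h_def)
      then show ?thesis using coord[OF r dg] incr[OF g] by (simp add: osc_def)
    next
      case False
      then have "r = t" by (simp add: r_def)
      moreover have "0 \<le> osc h" unfolding osc_def by (rule ell1_norm_nonneg[OF w dg])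
      ultimately show ?thesis using C(1) wk by simp
    qed
    show ?thesis using 1 2 by (simp add: distrib_left h_def[symmetric])
  qed
  have "((\<lambda>s. C / w k * (err \<bar>s - t\<bar> + osc \<bar>s - t\<bar>)) \<longlongrightarrow> C / w k * (0 + 0)) (at t within {0..})"
    by (intro tendsto_intros filterlim_compose[OF err dist] filterlim_compose[OF osc dist])
  then have bound_lim: "((\<lambda>s. C / w k * (err \<bar>s - t\<bar> + osc \<bar>s - t\<bar>)) \<longlongrightarrow> 0) (at t within {0..})"
    by simp
  have "\<forall>\<^sub>F s in at t within {0..}.
      norm ((S s f k - S t f k) / (s - t) - S t g k) \<le> C / w k * (err \<bar>s - t\<bar> + osc \<bar>s - t\<bar>)"
    unfolding eventually_at using \<delta> est by (intro exI[of _ \<delta>]) (auto simp: dist_real_def)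
  then have "((\<lambda>s. (S s f k - S t f k) / (s - t) - S t g k) \<longlongrightarrow> 0) (at t within {0..})"
    using bound_lim by (rule Lim_null_comparison)
  then show ?thesis
    unfolding has_field_derivative_iff by (simp add: Lim_null[symmetric])
qed

section \<open>Scalar differential inequalities and exponential decay\<close>

lemma linear_differential_inequality:
  fixes f :: "real \<Rightarrow> real"
  assumes deriv: "\<And>t. 0 \<le> t \<Longrightarrow> (f has_real_derivative f' t) (at t within {0..})"
    and ineq: "\<And>t. 0 \<le> t \<Longrightarrow> 0 \<le> f' t + c * f t"
    and init: "0 \<le> f 0" and t: "0 \<le> t"
  shows "0 \<le> f t"
proof -
  \<comment> \<open>Integrating factor: the derivative of \<open>g\<close> is the nonnegative
    expression in \<open>ineq\<close> times an exponential.\<close>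
  define g where "g s = exp (c * s) * f s" for s
  have g: "(g has_real_derivative exp (c * s) * (f' s + c * f s)) (at s within {0..})"
    if "0 \<le> s" for s
    unfolding g_def
    by (rule derivative_eq_intros deriv that refl | simp add: algebra_simps)+
  have "g 0 \<le> g t"
  proof (rule DERIV_nonneg_imp_increasing_open[OF t])
    show "\<exists>y. DERIV g x :> y \<and> 0 \<le> y" if "0 < x" "x < t" for x
      using g[of x] ineq[of x] that at_within_interior[of x "{0..}"]
      by (intro exI[of _ "exp (c * x) * (f' x + c * f x)"]) (auto simp: interior_real_atLeast)
    have "continuous_on {0..} g" by (rule DERIV_continuous_on[OF g]) simp
    then show "continuous_on {0..t} g" by (rule continuous_on_subset) auto
  qed
  then have "0 \<le> exp (c * t) * f t" using init by (simp add: g_def)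
  then show ?thesis by (simp add: zero_le_mult_iff)
qed

lemma exp_decay_at_top:
  fixes \<gamma> :: real
  assumes "0 < \<gamma>"
  shows "((\<lambda>t. exp (- \<gamma> * t)) \<longlongrightarrow> 0) at_top"
proof -
  have "filterlim (\<lambda>t. \<gamma> * t) at_top at_top"
    using assms by (intro filterlim_tendsto_pos_mult_at_top[OF tendsto_const]) (auto simp: filterlim_ident)
  then have "filterlim (\<lambda>t. - (\<gamma> * t)) at_bot at_top"
    by (simp add: filterlim_uminus_at_top)
  then show ?thesis by (simp add: filterlim_compose[OF exp_at_bot])
qed

section \<open>The fragmentation semigroup\<close>

text \<open>The constant \<open>\<kappa>\<close> is passed to individual lemmas, since it is at most
  1 in part (i) and below 1 in part (ii).\<close>

locale fragmentation_semigroup =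
  fixes a :: "nat \<Rightarrow> real" and b :: "nat \<Rightarrow> nat \<Rightarrow> real" and w :: "nat \<Rightarrow> real"
    and S :: "real \<Rightarrow> (nat \<Rightarrow> real) \<Rightarrow> (nat \<Rightarrow> real)"
  assumes a_nonneg: "1 \<le> n \<Longrightarrow> 0 \<le> a n"
    and b_nonneg: "1 \<le> n \<Longrightarrow> 1 \<le> j \<Longrightarrow> 0 \<le> b n j"
    and a_one: "a 1 = 0"
    and mass: "2 \<le> j \<Longrightarrow> (\<Sum>n = 1..j - 1. real n * b n j) = real j"
    and w_weight: "weight w"
    and w_ge: "1 \<le> n \<Longrightarrow> real n \<le> w n"
    and S_gen: "generates w (op_closure w (op_sum (A_op a w) (B_op a b w))) S"
begin

lemma w_pos: "1 \<le> n \<Longrightarrow> 0 < w n"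
  using w_weight by (simp add: weight_def)

lemma S_C0: "C0_semigroup w S"
  using S_gen by (simp add: generates_def)

lemmas S_bounded = C0_semigroup_bounded[OF S_C0]
lemmas S_mem = bounded_operator_mem[OF S_bounded]

text \<open>Both operators map a unit sequence to a finitely supported one, so it lies in the domain
  of their sum. Constant sequences then put the pair into the closure, which is the
  generator.\<close>

lemma unit_seq_generator:
  assumes m: "1 \<le> m"
  shows "(unit_seq m, \<lambda>k. - a m * unit_seq m k + (\<Sum>n = 1..m - 1. a m * b n m * unit_seq n k))
    \<in> generator w S"
proof -
  define g where "g k = - a k * unit_seq m k" for k
  define h where "h k = (\<Sum>n = 1..m - 1. a m * b n m * unit_seq n k)" for k
  have h: "h k = (if k \<in> {1..m - 1} then a m * b k m else 0)" for k
    unfolding h_def by (rule unit_seq_expansion)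
  have um: "unit_seq m \<in> ell1 w" by (rule unit_seq_ell1(1)[OF m])
  have g_mem: "g \<in> ell1 w"
    by (rule ell1_finite_support(1)[of _ m]) (use m in \<open>auto simp: g_def unit_seq_def\<close>)
  have h_mem: "h \<in> ell1 w" by (rule ell1_finite_support(1)[of _ m]) (auto simp: h)
  \<comment> \<open>Only \<open>j = m\<close>, that is \<open>i = m - n - 1\<close>, can contribute
    to this series, and it occurs only for \<open>n < m\<close>.\<close>
  have "(\<lambda>i. a (n + 1 + i) * b n (n + 1 + i) * unit_seq m (n + 1 + i)) sums h n" if n: "1 \<le> n" for n
  proof (cases "n < m")
    case True
    then have "(\<lambda>i. a (n + 1 + i) * b n (n + 1 + i) * unit_seq m (n + 1 + i)) sums
        (\<Sum>i\<in>{m - n - 1}. a (n + 1 + i) * b n (n + 1 + i) * unit_seq m (n + 1 + i))"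
      by (intro sums_finite) (auto simp: unit_seq_def)
    also have "(\<Sum>i\<in>{m - n - 1}. a (n + 1 + i) * b n (n + 1 + i) * unit_seq m (n + 1 + i)) = h n"
      using True n by (auto simp: h unit_seq_def)
    finally show ?thesis .
  next
    case False
    then have "h n = 0" and "\<And>i. unit_seq m (n + 1 + i) = 0" by (auto simp: h unit_seq_def)
    then show ?thesis by simp
  qed
  then have "(unit_seq m, h) \<in> B_op a b w" using um h_mem by (simp add: B_op_def)
  moreover have "(unit_seq m, g) \<in> A_op a w"
    using um g_mem by (auto simp: A_op_def g_def)
  ultimately have "(unit_seq m, \<lambda>k. g k + h k) \<in> op_sum (A_op a w) (B_op a b w)"
    by (auto simp: op_sum_def)
  then have "(unit_seq m, \<lambda>k. g k + h k) \<in> op_closure w (op_sum (A_op a w) (B_op a b w))"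
    using um ell1_add(1)[OF w_weight g_mem h_mem]
    by (simp add: op_closure_def)
      (rule exI[of _ "\<lambda>_. unit_seq m"], rule exI[of _ "\<lambda>_ k. g k + h k"], simp add: ell1_norm_def)
  moreover have "(\<lambda>k. g k + h k) =
      (\<lambda>k. - a m * unit_seq m k + (\<Sum>n = 1..m - 1. a m * b n m * unit_seq n k))"
    by (auto simp: g_def h_def unit_seq_def)
  ultimately show ?thesis using S_gen by (simp add: generates_def)
qed

text \<open>The backward equation: it couples the unknowns only through the initial index \<open>m\<close>, so every
  linear functional of the orbits of the unit sequences satisfies the same triangular system.\<close>

lemma unit_orbit_derivative:
  assumes m: "1 \<le> m" and t: "0 \<le> t" and k: "1 \<le> k"
  shows "((\<lambda>t. S t (unit_seq m) k) has_real_derivative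
    a m * ((\<Sum>n = 1..m - 1. b n m * S t (unit_seq n) k) - S t (unit_seq m) k)) (at t within {0..})"
proof -
  have um: "(\<lambda>k. - a m * unit_seq m k) \<in> ell1 w"
    by (rule ell1_scale(1)[OF unit_seq_ell1(1)[OF m]])
  have un: "unit_seq n \<in> ell1 w" if "n \<in> {1..m - 1}" for n
    using that by (intro unit_seq_ell1) auto
  have sum_mem: "(\<lambda>k. \<Sum>n = 1..m - 1. a m * b n m * unit_seq n k) \<in> ell1 w"
    by (intro ell1_sum(1)[OF w_weight] ell1_scale(1) un) auto
  have "S t (\<lambda>k. - a m * unit_seq m k + (\<Sum>n = 1..m - 1. a m * b n m * unit_seq n k)) k =
      - a m * S t (unit_seq m) k + (\<Sum>n = 1..m - 1. a m * b n m * S t (unit_seq n) k)"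
    unfolding bounded_operator_add[OF S_bounded[OF t] um sum_mem]
      bounded_operator_scale[OF S_bounded[OF t] unit_seq_ell1(1)[OF m]]
    by (subst bounded_operator_sum[OF S_bounded[OF t] w_weight _ un]) auto
  also have "\<dots> = a m * ((\<Sum>n = 1..m - 1. b n m * S t (unit_seq n) k) - S t (unit_seq m) k)"
    by (simp add: sum_distrib_left algebra_simps)
  finally show ?thesis
    using generator_orbit_derivative[OF w_weight S_C0 unit_seq_generator[OF m] t k] by simp
qed

lemma functional_orbit_derivative:
  assumes m: "1 \<le> m" and t: "0 \<le> t" and K: "K \<subseteq> {1..}"
  shows "((\<lambda>t. \<Sum>k\<in>K. v k * S t (unit_seq m) k) has_real_derivative
    a m * ((\<Sum>n = 1..m - 1. b n m * (\<Sum>k\<in>K. v k * S t (unit_seq n) k)) -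
      (\<Sum>k\<in>K. v k * S t (unit_seq m) k))) (at t within {0..})"
proof -
  have "((\<lambda>t. \<Sum>k\<in>K. v k * S t (unit_seq m) k) has_real_derivative
      (\<Sum>k\<in>K. v k * (a m * ((\<Sum>n = 1..m - 1. b n m * S t (unit_seq n) k) - S t (unit_seq m) k))))
      (at t within {0..})"
    using K by (intro DERIV_sum DERIV_cmult unit_orbit_derivative m t) auto
  moreover have "(\<Sum>k\<in>K. v k * (\<Sum>n = 1..m - 1. b n m * S t (unit_seq n) k)) =
      (\<Sum>n = 1..m - 1. b n m * (\<Sum>k\<in>K. v k * S t (unit_seq n) k))"
    by (simp add: sum_distrib_left mult.left_commute sum.swap[of _ _ K])
  moreover have "(\<Sum>k\<in>K. v k * (a m * (X k - Y k))) =
      a m * ((\<Sum>k\<in>K. v k * X k) - (\<Sum>k\<in>K. v k * Y k))" for X Y :: "nat \<Rightarrow> real"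
    by (simp add: sum_distrib_left sum_subtractf algebra_simps)
  ultimately show ?thesis by simp
qed

section \<open>Comparison principle and properties of the unit orbits\<close>

text \<open>The system is triangular with nonnegative coefficients: by induction the lower indices
  act as a nonnegative source, and a scalar inequality with coefficient \<open>a m\<close> remains.
  The bound \<open>N\<close> confines the hypotheses to finitely many indices, as needed when they
  hold only up to a cutoff.\<close>

lemma backward_comparison:
  assumes deriv: "\<And>m t. 1 \<le> m \<Longrightarrow> m \<le> N \<Longrightarrow> 0 \<le> t \<Longrightarrow>
      (r m has_real_derivative r' m t) (at t within {0..})"
    and ineq: "\<And>m t. 1 \<le> m \<Longrightarrow> m \<le> N \<Longrightarrow> 0 \<le> t \<Longrightarrow>
      a m * ((\<Sum>n = 1..m - 1. b n m * r n t) - r m t) \<le> r' m t"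
    and init: "\<And>m. 1 \<le> m \<Longrightarrow> m \<le> N \<Longrightarrow> 0 \<le> r m 0"
    and "1 \<le> m" "m \<le> N" "0 \<le> t"
  shows "0 \<le> r m t"
  using assms(4-6)
proof (induction m arbitrary: t rule: less_induct)
  case (less m)
  show ?case
  proof (rule linear_differential_inequality[of "r m" "r' m" "a m"])
    fix s :: real
    assume s: "0 \<le> s"
    have "0 \<le> a m * (\<Sum>n = 1..m - 1. b n m * r n s)"
      using less s by (intro mult_nonneg_nonneg sum_nonneg a_nonneg b_nonneg less.IH) auto
    then show "0 \<le> r' m s + a m * r m s"
      using ineq[OF less.prems(1,2) s] by (simp add: algebra_simps)
  qed (use less.prems deriv init in auto)
qed

lemma S_zero_unit: "1 \<le> m \<Longrightarrow> S 0 (unit_seq m) = unit_seq m"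
  using S_C0 unit_seq_ell1(1)[of m w] by (simp add: C0_semigroup_def)

lemma S_zero_unit_apply: "1 \<le> m \<Longrightarrow> S 0 (unit_seq m) k = (if k = m then 1 else 0)"
  by (simp add: S_zero_unit) (simp add: unit_seq_def)

lemma unit_orbit_nonneg:
  assumes k: "1 \<le> k" and m: "1 \<le> m" and t: "0 \<le> t"
  shows "0 \<le> S t (unit_seq m) k"
proof (rule backward_comparison[where N = m and r = "\<lambda>m t. S t (unit_seq m) k"])
  show "0 \<le> S 0 (unit_seq m) k" if "1 \<le> m" for m
    using that by (simp add: S_zero_unit_apply)
qed (rule unit_orbit_derivative k m t order.refl | assumption)+

text \<open>Comparison for the negated component gives one inequality, positivity the other. With
  \<open>N = k - 1\<close> only starting indices whose component \<open>k\<close> is initially 0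
  take part.\<close>

lemma unit_orbit_support:
  assumes m: "1 \<le> m" "m < k" and t: "0 \<le> t"
  shows "S t (unit_seq m) k = 0"
proof -
  have "0 \<le> - S t (unit_seq m) k"
  proof (rule backward_comparison[where N = "k - 1" and r = "\<lambda>m t. - S t (unit_seq m) k"])
    show "((\<lambda>t. - S t (unit_seq m) k) has_real_derivative
        - (a m * ((\<Sum>n = 1..m - 1. b n m * S t (unit_seq n) k) - S t (unit_seq m) k)))
        (at t within {0..})" if "1 \<le> m" "m \<le> k - 1" "0 \<le> t" for m t
      using that by (intro DERIV_minus unit_orbit_derivative) auto
    show "a m * ((\<Sum>n = 1..m - 1. b n m * - S t (unit_seq n) k) - - S t (unit_seq m) k) \<le>
        - (a m * ((\<Sum>n = 1..m - 1. b n m * S t (unit_seq n) k) - S t (unit_seq m) k))" for m t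
      by (simp add: sum_negf algebra_simps)
    show "0 \<le> - S 0 (unit_seq m) k" if "1 \<le> m" "m \<le> k - 1" for m
      using that by (simp add: S_zero_unit_apply)
  qed (use m t in auto)
  then show ?thesis using unit_orbit_nonneg[of k m t] assms by simp
qed

text \<open>By triangularity the coupling term vanishes, so the diagonal entry solves a scalar
  linear equation. Two opposite differential inequalities yield uniqueness.\<close>

lemma unit_orbit_diagonal:
  assumes m: "1 \<le> m" and t: "0 \<le> t"
  shows "S t (unit_seq m) m = exp (- a m * t)"
proof -
  have deriv: "((\<lambda>t. S t (unit_seq m) m) has_real_derivative - a m * S t (unit_seq m) m)
      (at t within {0..})" if "0 \<le> t" for t
  proof -
    have "(\<Sum>n = 1..m - 1. b n m * S t (unit_seq n) m) = 0"
      using that m by (intro sum.neutral) (auto simp: unit_orbit_support)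
    then show ?thesis using unit_orbit_derivative[OF m that m] by simp
  qed
  have init: "S 0 (unit_seq m) m = 1" using m by (simp add: S_zero_unit_apply)
  have expd: "((\<lambda>t. exp (- a m * t)) has_real_derivative - a m * exp (- a m * t))
      (at t within {0..})" for t
    by (auto intro!: derivative_eq_intros)
  have "0 \<le> S t (unit_seq m) m - exp (- a m * t)"
    by (rule linear_differential_inequality[where c = "a m", OF DERIV_diff[OF deriv expd] _ _ t])
      (auto simp: init algebra_simps)
  moreover have "0 \<le> exp (- a m * t) - S t (unit_seq m) m"
    by (rule linear_differential_inequality[where c = "a m", OF DERIV_diff[OF expd deriv] _ _ t])
      (auto simp: init algebra_simps)
  ultimately show ?thesis by simp
qed

text \<open>The mass identity makes \<open>real m\<close> a stationary solution of the backward
  system. The moment truncated at a common cutoff \<open>N\<close> solves the same system with the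
  same initial values, and comparison of the difference in both signs gives equality.\<close>

lemma unit_orbit_mass:
  assumes m: "1 \<le> m" "m \<le> N" and t: "0 \<le> t"
  shows "(\<Sum>k = 1..N. real k * S t (unit_seq m) k) = real m"
proof -
  let ?M = "\<lambda>m t. \<Sum>k = 1..N. real k * S t (unit_seq m) k"
  \<comment> \<open>The factor \<open>a m\<close> covers \<open>m = 1\<close>, where the sum is
    empty but \<open>a 1 = 0\<close>.\<close>
  have mass': "a m * (\<Sum>n = 1..m - 1. b n m * real n) = a m * real m" if "1 \<le> m" for m
    using mass[of m] a_one that by (cases "m = 1") (auto simp: mult.commute)
  have init: "?M m 0 = real m" if "1 \<le> m" "m \<le> N" for m
    using that by (simp add: S_zero_unit sum_unit_seq)
  have deriv: "(?M m has_real_derivative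
      a m * ((\<Sum>n = 1..m - 1. b n m * ?M n t) - ?M m t)) (at t within {0..})"
    if "1 \<le> m" "0 \<le> t" for m t
    using that by (intro functional_orbit_derivative) auto
  have "0 \<le> ?M m t - real m"
  proof (rule backward_comparison[where N = N and r = "\<lambda>m t. ?M m t - real m"])
    show "((\<lambda>t. ?M m t - real m) has_real_derivative
        a m * ((\<Sum>n = 1..m - 1. b n m * ?M n t) - ?M m t)) (at t within {0..})"
      if "1 \<le> m" "m \<le> N" "0 \<le> t" for m t
      using DERIV_diff[OF deriv[OF that(1,3)] DERIV_const[of "real m"]] by simp
    show "a m * ((\<Sum>n = 1..m - 1. b n m * (?M n t - real n)) - (?M m t - real m))
        \<le> a m * ((\<Sum>n = 1..m - 1. b n m * ?M n t) - ?M m t)"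
      if "1 \<le> m" "m \<le> N" "0 \<le> t" for m t
    proof -
      have "a m * ((\<Sum>n = 1..m - 1. b n m * (?M n t - real n)) - (?M m t - real m)) =
          a m * ((\<Sum>n = 1..m - 1. b n m * ?M n t) - ?M m t) +
          (a m * real m - a m * (\<Sum>n = 1..m - 1. b n m * real n))"
        by (simp add: right_diff_distrib sum_subtractf)
      then show ?thesis using mass'[OF that(1)] by linarith
    qed
  qed (use m t init in auto)
  moreover have "0 \<le> real m - ?M m t"
  proof (rule backward_comparison[where N = N and r = "\<lambda>m t. real m - ?M m t"])
    show "((\<lambda>t. real m - ?M m t) has_real_derivative
        - (a m * ((\<Sum>n = 1..m - 1. b n m * ?M n t) - ?M m t))) (at t within {0..})"
      if "1 \<le> m" "m \<le> N" "0 \<le> t" for m t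
      using DERIV_diff[OF DERIV_const[of "real m"] deriv[OF that(1,3)]] by simp
    show "a m * ((\<Sum>n = 1..m - 1. b n m * (real n - ?M n t)) - (real m - ?M m t))
        \<le> - (a m * ((\<Sum>n = 1..m - 1. b n m * ?M n t) - ?M m t))"
      if "1 \<le> m" "m \<le> N" "0 \<le> t" for m t
    proof -
      have "a m * ((\<Sum>n = 1..m - 1. b n m * (real n - ?M n t)) - (real m - ?M m t)) =
          - (a m * ((\<Sum>n = 1..m - 1. b n m * ?M n t) - ?M m t)) +
          (a m * (\<Sum>n = 1..m - 1. b n m * real n) - a m * real m)"
        by (simp add: right_diff_distrib sum_subtractf)
      then show ?thesis using mass'[OF that(1)] by linarith
    qed
  qed (use m t init in auto)
  ultimately show ?thesis by simp
qed

text \<open>The hypothesis makes \<open>v m * exp (- \<gamma> * t)\<close> a supersolution of the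
  equations for the tail. The weight \<open>v\<close> stays open because both \<open>w\<close> and
  the squares are used.\<close>

lemma unit_orbit_tail:
  assumes cond: "\<And>j. 2 \<le> j \<Longrightarrow> j \<le> N \<Longrightarrow>
      a j * (\<Sum>n = 2..j - 1. v n * b n j) \<le> (a j - \<gamma>) * v j"
    and m: "2 \<le> m" "m \<le> N" and t: "0 \<le> t"
  shows "(\<Sum>k = 2..N. v k * S t (unit_seq m) k) \<le> v m * exp (- \<gamma> * t)"
proof -
  let ?T = "\<lambda>m t. \<Sum>k = 2..N. v k * S t (unit_seq m) k"
  \<comment> \<open>Comparison runs over all indices from 1. The value 0 at index 1 is the initial
    tail there, and it removes the term \<open>n = 1\<close> from the sums.\<close>
  define V where "V m = (if 2 \<le> m then v m else 0)" for m
  have V: "a m * ((\<Sum>n = 1..m - 1. b n m * V n) - V m) \<le> - \<gamma> * V m" if "1 \<le> m" "m \<le> N" for m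
  proof (cases "m = 1")
    case False
    then have "(\<Sum>n = 1..m - 1. b n m * V n) = (\<Sum>n = 2..m - 1. v n * b n m)"
      by (intro sum.mono_neutral_cong_right) (auto simp: V_def)
    then show ?thesis using cond[of m] that False by (simp add: V_def algebra_simps)
  qed (simp add: V_def)
  have "0 \<le> V m * exp (- \<gamma> * t) - ?T m t"
  proof (rule backward_comparison[where N = N and r = "\<lambda>m t. V m * exp (- \<gamma> * t) - ?T m t"])
    show "((\<lambda>t. V m * exp (- \<gamma> * t) - ?T m t) has_real_derivative
        - \<gamma> * V m * exp (- \<gamma> * t) - a m * ((\<Sum>n = 1..m - 1. b n m * ?T n t) - ?T m t))
        (at t within {0..})"
      if "1 \<le> m" "m \<le> N" "0 \<le> t" for m t
    proof (rule DERIV_diff)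
      show "((\<lambda>t. V m * exp (- \<gamma> * t)) has_real_derivative - \<gamma> * V m * exp (- \<gamma> * t))
          (at t within {0..})"
        by (auto intro!: derivative_eq_intros)
    qed (use that in \<open>intro functional_orbit_derivative; auto\<close>)
    show "a m * ((\<Sum>n = 1..m - 1. b n m * (V n * exp (- \<gamma> * t) - ?T n t)) -
          (V m * exp (- \<gamma> * t) - ?T m t))
        \<le> - \<gamma> * V m * exp (- \<gamma> * t) - a m * ((\<Sum>n = 1..m - 1. b n m * ?T n t) - ?T m t)"
      if "1 \<le> m" "m \<le> N" "0 \<le> t" for m t
    proof -
      have "(\<Sum>n = 1..m - 1. b n m * (V n * E - Y n)) =
          (\<Sum>n = 1..m - 1. b n m * V n) * E - (\<Sum>n = 1..m - 1. b n m * Y n)" for E and Y :: "nat \<Rightarrow> real"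
        by (simp only: right_diff_distrib sum_subtractf sum_distrib_right mult.assoc)
      moreover have "c * ((x * E - y) - (z * E - u)) = c * (x - z) * E - c * (y - u)"
        for c x y z u E :: real
        by algebra
      ultimately have "a m * ((\<Sum>n = 1..m - 1. b n m * (V n * exp (- \<gamma> * t) - ?T n t)) -
            (V m * exp (- \<gamma> * t) - ?T m t)) =
          a m * ((\<Sum>n = 1..m - 1. b n m * V n) - V m) * exp (- \<gamma> * t) -
            a m * ((\<Sum>n = 1..m - 1. b n m * ?T n t) - ?T m t)"
        by (simp only:)
      then show ?thesis
        using mult_right_mono[OF V[OF that(1,2)] exp_ge_zero, of "- \<gamma> * t"] by linarith
    qed
    show "0 \<le> V m * exp (- \<gamma> * 0) - ?T m 0" if "1 \<le> m" "m \<le> N" for m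
      using that by (simp add: S_zero_unit sum_unit_seq V_def)
  qed (use m t in auto)
  then show ?thesis using m by (simp add: V_def)
qed

section \<open>The first moment and the deviation from the limit state\<close>

lemma M1_term_le:
  assumes "f \<in> ell1 w"
  shows "\<bar>real n * f n\<bar> \<le> w n * \<bar>f n\<bar>"
  using assms w_ge[of n] by (cases "n = 0") (auto simp: ell1_def abs_mult intro: mult_right_mono)

lemma M1_summable: "f \<in> ell1 w \<Longrightarrow> summable (\<lambda>n. \<bar>real n * f n\<bar>)"
  by (rule summable_comparison_test'[OF ell1_summable, where N = 0]) (use M1_term_le in auto)

lemma abs_M1_le:
  assumes "f \<in> ell1 w"
  shows "\<bar>M1 f\<bar> \<le> ell1_norm w f"
proof -
  have "\<bar>M1 f\<bar> \<le> (\<Sum>n. \<bar>real n * f n\<bar>)"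
    unfolding M1_def by (rule summable_rabs[OF M1_summable[OF assms]])
  also have "\<dots> \<le> ell1_norm w f"
    unfolding ell1_norm_def
    by (intro suminf_le M1_term_le M1_summable ell1_summable assms)
  finally show ?thesis .
qed

lemma M1_unit_seq: "M1 (unit_seq m) = real m"
proof -
  have "(\<lambda>n. real n * unit_seq m n) sums (\<Sum>n\<in>{m}. real n * unit_seq m n)"
    by (rule sums_finite) (auto simp: unit_seq_def)
  then show ?thesis by (simp add: M1_def sums_iff unit_seq_def)
qed

text \<open>The semigroup minus its expected limit, an operator of rank one. Taken as one bounded
  operator, the difference can be estimated on unit sequences alone.\<close>

definition deviation :: "real \<Rightarrow> (nat \<Rightarrow> real) \<Rightarrow> nat \<Rightarrow> real" where
  "deviation t u = (\<lambda>n. S t u n - M1 u * e1 n)"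

lemma e1_mem: "e1 \<in> ell1 w" and e1_norm: "ell1_norm w e1 = w 1"
  using unit_seq_ell1[of 1 w, unfolded unit_seq_1] by simp_all

lemma deviation_bounded:
  assumes t: "0 \<le> t"
  shows "bounded_operator w (deviation t)"
  unfolding bounded_operator_def
proof (intro conjI ballI allI)
  note St = S_bounded[OF t]
  have M1e: "(\<lambda>n. M1 f * e1 n) \<in> ell1 w" for f by (rule ell1_scale(1)[OF e1_mem])
  fix f assume f: "f \<in> ell1 w"
  show "deviation t f \<in> ell1 w"
    unfolding deviation_def by (intro ell1_diff(1)[OF w_weight] S_mem[OF t] f M1e)
  show "deviation t (\<lambda>n. c * f n) = (\<lambda>n. c * deviation t f n)" for c
  proof -
    have "M1 (\<lambda>n. c * f n) = c * M1 f"
      unfolding M1_def using suminf_mult[OF summable_rabs_cancel[OF M1_summable[OF f]], of c]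
      by (simp add: mult.left_commute)
    then show ?thesis
      unfolding deviation_def bounded_operator_scale[OF St f]
      by (simp add: right_diff_distrib mult.assoc)
  qed
  fix g assume g: "g \<in> ell1 w"
  have "M1 (\<lambda>n. f n + g n) = M1 f + M1 g"
    unfolding M1_def
    using suminf_add[OF summable_rabs_cancel[OF M1_summable[OF f]]
        summable_rabs_cancel[OF M1_summable[OF g]]]
    by (simp add: distrib_left)
  then show "deviation t (\<lambda>n. f n + g n) = (\<lambda>n. deviation t f n + deviation t g n)"
    unfolding deviation_def bounded_operator_add[OF St f g] by (simp add: algebra_simps)
next
  obtain C where C: "\<And>f. f \<in> ell1 w \<Longrightarrow> ell1_norm w (S t f) \<le> C * ell1_norm w f"
    using bounded_operator_bound[OF w_weight S_bounded[OF t]] by blast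
  have "ell1_norm w (deviation t f) \<le> (C + w 1) * ell1_norm w f" if f: "f \<in> ell1 w" for f
  proof -
    have "ell1_norm w (deviation t f) \<le> ell1_norm w (S t f) + ell1_norm w (\<lambda>n. M1 f * e1 n)"
      unfolding deviation_def
      by (intro ell1_diff(2)[OF w_weight] S_mem[OF t] f ell1_scale(1) e1_mem)
    also have "\<dots> \<le> C * ell1_norm w f + ell1_norm w f * w 1"
      unfolding ell1_scale(2)[OF e1_mem] e1_norm
      using w_pos[of 1] by (intro add_mono C f mult_right_mono abs_M1_le) auto
    finally show ?thesis by (simp add: algebra_simps)
  qed
  then show "\<exists>C. \<forall>f\<in>ell1 w. ell1_norm w (deviation t f) \<le> C * ell1_norm w f" by blast
qed

text \<open>Mass conservation expresses the defect in the first component by the tail.\<close>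

lemma deviation_unit_seq_le_tail:
  assumes m: "1 \<le> m" and t: "0 \<le> t"
  shows "ell1_norm w (deviation t (unit_seq m)) \<le>
    (w 1 + 1) * (\<Sum>k = 2..m. w k * S t (unit_seq m) k)"
proof -
  let ?p = "\<lambda>k. S t (unit_seq m) k"
  have p: "0 \<le> ?p k" if "1 \<le> k" for k using unit_orbit_nonneg[OF that m t] .
  have z: "deviation t (unit_seq m) 0 = 0"
    using ell1_zero_term[OF S_mem[OF t unit_seq_ell1(1)[OF m]]] by (simp add: deviation_def e1_def)
  have far: "deviation t (unit_seq m) n = 0" if "m < n" for n
    using unit_orbit_support[OF m that t] m that by (simp add: deviation_def e1_def)
  have split: "(\<Sum>k = 1..m. F k) = F 1 + (\<Sum>k = 2..m. F k)" for F :: "nat \<Rightarrow> real"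
    using m sum.atLeast_Suc_atMost[of 1 m F] by (simp add: numeral_2_eq_2)
  have "real m = ?p 1 + (\<Sum>k = 2..m. real k * ?p k)"
    using unit_orbit_mass[OF m order.refl t] split[of "\<lambda>k. real k * ?p k"] by simp
  moreover have "0 \<le> (\<Sum>k = 2..m. real k * ?p k)" by (intro sum_nonneg mult_nonneg_nonneg p) auto
  moreover have "(\<Sum>k = 2..m. real k * ?p k) \<le> (\<Sum>k = 2..m. w k * ?p k)"
    by (intro sum_mono mult_right_mono w_ge p) auto
  ultimately have 1: "\<bar>?p 1 - real m\<bar> \<le> (\<Sum>k = 2..m. w k * ?p k)" by linarith
  have "ell1_norm w (deviation t (unit_seq m)) = (\<Sum>n = 1..m. w n * \<bar>deviation t (unit_seq m) n\<bar>)"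
    by (rule ell1_finite_support(2)[of "deviation t (unit_seq m)", OF z far])
  \<comment> \<open>The first component contributes at most \<open>w 1\<close> times the tail and
    the others exactly the tail, whence the factor \<open>w 1 + 1\<close>.\<close>
  also have "\<dots> = w 1 * \<bar>?p 1 - real m\<bar> + (\<Sum>n = 2..m. w n * \<bar>deviation t (unit_seq m) n\<bar>)"
    unfolding split by (simp add: deviation_def M1_unit_seq e1_def)
  also have "(\<Sum>n = 2..m. w n * \<bar>deviation t (unit_seq m) n\<bar>) = (\<Sum>n = 2..m. w n * ?p n)"
    by (rule sum.cong) (auto simp: deviation_def e1_def abs_of_nonneg p)
  finally show ?thesis
    using mult_left_mono[OF 1, of "w 1"] w_pos[of 1] by (simp add: algebra_simps)
qed

section \<open>Decay and convergence of the deviation\<close>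

lemma deviation_decay:
  assumes cond: "\<And>j. 2 \<le> j \<Longrightarrow> a j * (\<Sum>n = 2..j - 1. w n * b n j) \<le> (a j - \<gamma>) * w j"
    and u: "u \<in> ell1 w" and t: "0 \<le> t"
  shows "ell1_norm w (deviation t u) \<le> (w 1 + 1) * exp (- \<gamma> * t) * ell1_norm w u"
proof (rule bounded_operator_norm_le[OF w_weight deviation_bounded[OF t] u])
  fix m :: nat
  assume m: "1 \<le> m"
  have "(\<Sum>k = 2..m. w k * S t (unit_seq m) k) \<le> w m * exp (- \<gamma> * t)"
  proof (cases "m = 1")
    case True
    then show ?thesis using w_pos[of 1] by simp
  next
    case False
    then show ?thesis using unit_orbit_tail[of m w \<gamma> m t] cond m t by simp
  qed
  then have "(w 1 + 1) * (\<Sum>k = 2..m. w k * S t (unit_seq m) k) \<le> (w 1 + 1) * (w m * exp (- \<gamma> * t))"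
    using w_pos[of 1] by (intro mult_left_mono) auto
  then show "ell1_norm w (deviation t (unit_seq m)) \<le> (w 1 + 1) * exp (- \<gamma> * t) * w m"
    using deviation_unit_seq_le_tail[OF m t] by (simp add: mult_ac)
qed

text \<open>Dropping the nonnegative term \<open>n = 1\<close> keeps the bound
  \<open>\<kappa> * w j\<close>, so relative to \<open>w j\<close> the loss exceeds the gain by at
  least \<open>(1 - \<kappa>) * a j\<close>, hence by \<open>(1 - \<kappa>) * \<alpha>\<close>. This
  feeds \<open>deviation_decay\<close>; for \<open>\<alpha> = 0\<close> it yields boundedness even
  if \<open>\<kappa> = 1\<close>.\<close>

lemma weight_cond_tail:
  assumes \<kappa>: "\<kappa> \<le> 1" "weight_cond b w \<kappa>" and lower: "\<And>j. 2 \<le> j \<Longrightarrow> \<alpha> \<le> a j" and j: "2 \<le> j"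
  shows "a j * (\<Sum>n = 2..j - 1. w n * b n j) \<le> (a j - (1 - \<kappa>) * \<alpha>) * w j"
proof -
  have "(\<Sum>n = 2..j - 1. w n * b n j) \<le> (\<Sum>n = 1..j - 1. w n * b n j)"
    using j by (intro sum_mono2 mult_nonneg_nonneg b_nonneg less_imp_le[OF w_pos]) auto
  also have "\<dots> \<le> \<kappa> * w j" using \<kappa>(2) j by (simp add: weight_cond_def)
  finally have "a j * (\<Sum>n = 2..j - 1. w n * b n j) \<le> a j * (\<kappa> * w j)"
    using a_nonneg[of j] j by (intro mult_left_mono) auto
  also have "\<dots> = a j * \<kappa> * w j" by simp
  also have "\<dots> \<le> (a j - (1 - \<kappa>) * \<alpha>) * w j"
    using mult_left_mono[OF lower[OF j], of "1 - \<kappa>"] \<kappa>(1) w_pos[of j] j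
    by (intro mult_right_mono) (auto simp: algebra_simps)
  finally show ?thesis .
qed

text \<open>On the first \<open>m\<close> components the quadratic weight \<open>n\<^sup>2\<close> contracts strictly, whatever \<open>\<kappa>\<close> is:
  \<open>\<Sum>n<j. n\<^sup>2 * b n j \<le> (j - 1) * j\<close>.\<close>

lemma unit_orbit_quadratic_tail:
  assumes a_pos: "\<And>j. 2 \<le> j \<Longrightarrow> 0 < a j" and m: "2 \<le> m"
  obtains \<gamma> where "0 < \<gamma>"
    "\<And>t. 0 \<le> t \<Longrightarrow> (\<Sum>k = 2..m. (real k)\<^sup>2 * S t (unit_seq m) k) \<le> (real m)\<^sup>2 * exp (- \<gamma> * t)"
proof
  \<comment> \<open>For the quadratic weight the loss exceeds the gain by at least
    \<open>a j * j\<close>, which is \<open>a j / j\<close> times the weight. With finitely many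
    indices the least of these rates is positive.\<close>
  define \<gamma> where "\<gamma> = Min ((\<lambda>j. a j / real j) ` {2..m})"
  have "\<gamma> \<in> (\<lambda>j. a j / real j) ` {2..m}" unfolding \<gamma>_def using m by (intro Min_in) auto
  then show "0 < \<gamma>" using a_pos by auto
  have \<gamma>_le: "\<gamma> * real j \<le> a j" if "2 \<le> j" "j \<le> m" for j
  proof -
    have "\<gamma> \<le> a j / real j" unfolding \<gamma>_def using that by (intro Min_le) auto
    then show ?thesis using that by (simp add: field_simps)
  qed
  show "(\<Sum>k = 2..m. (real k)\<^sup>2 * S t (unit_seq m) k) \<le> (real m)\<^sup>2 * exp (- \<gamma> * t)" if "0 \<le> t" for t
  proof (rule unit_orbit_tail[where N = m and v = "\<lambda>n. (real n)\<^sup>2", OF _ m order.refl that])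
    fix j assume j: "2 \<le> j" "j \<le> m"
    have "(\<Sum>n = 2..j - 1. (real n)\<^sup>2 * b n j) \<le> (\<Sum>n = 1..j - 1. (real n)\<^sup>2 * b n j)"
      using j by (intro sum_mono2 mult_nonneg_nonneg b_nonneg) auto
    also have "\<dots> \<le> (\<Sum>n = 1..j - 1. (real j - 1) * (real n * b n j))"
    proof (rule sum_mono)
      fix n assume n: "n \<in> {1..j - 1}"
      then have "real n * (real n * b n j) \<le> (real j - 1) * (real n * b n j)"
        using j b_nonneg[of n j] by (intro mult_right_mono mult_nonneg_nonneg) auto
      then show "(real n)\<^sup>2 * b n j \<le> (real j - 1) * (real n * b n j)"
        by (simp add: power2_eq_square mult.assoc)
    qed
    also have "\<dots> = (real j - 1) * real j"
      unfolding sum_distrib_left[symmetric] mass[OF j(1)] ..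
    finally have "a j * (\<Sum>n = 2..j - 1. (real n)\<^sup>2 * b n j) \<le> a j * ((real j - 1) * real j)"
      using a_nonneg[of j] j by (intro mult_left_mono) auto
    also have "\<dots> = a j * (real j)\<^sup>2 - a j * real j" by (simp add: power2_eq_square algebra_simps)
    also have "\<dots> \<le> a j * (real j)\<^sup>2 - (\<gamma> * real j) * real j"
      using mult_right_mono[OF \<gamma>_le[OF j], of "real j"] by simp
    also have "\<dots> = (a j - \<gamma>) * (real j)\<^sup>2" by (simp add: power2_eq_square algebra_simps)
    finally show "a j * (\<Sum>n = 2..j - 1. (real n)\<^sup>2 * b n j) \<le> (a j - \<gamma>) * (real j)\<^sup>2" .
  qed
qed

text \<open>Only finitely many components occur. As \<open>k^2\<close> is at least 1, the quadratic
  tail bound forces each component with \<open>k \<ge> 2\<close> to 0, and the weights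
  \<open>w k\<close> are then mere constants. The rate depends on \<open>m\<close>.\<close>

lemma deviation_unit_seq_tendsto:
  assumes a_pos: "\<And>j. 2 \<le> j \<Longrightarrow> 0 < a j" and m: "1 \<le> m"
  shows "((\<lambda>t. ell1_norm w (deviation t (unit_seq m))) \<longlongrightarrow> 0) at_top"
proof -
  have orbit: "((\<lambda>t. S t (unit_seq m) k) \<longlongrightarrow> 0) at_top" if k: "k \<in> {2..m}" for k
  proof -
    have m2: "2 \<le> m" using k by simp
    obtain \<gamma> where \<gamma>: "0 < \<gamma>"
      "\<And>t. 0 \<le> t \<Longrightarrow> (\<Sum>k = 2..m. (real k)\<^sup>2 * S t (unit_seq m) k) \<le> (real m)\<^sup>2 * exp (- \<gamma> * t)"
      using unit_orbit_quadratic_tail[OF a_pos m2] by blast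
    have bound: "\<bar>S t (unit_seq m) k\<bar> \<le> (real m)\<^sup>2 * exp (- \<gamma> * t)" if t: "0 \<le> t" for t
    proof -
      have p: "0 \<le> S t (unit_seq m) j" if "j \<in> {2..m}" for j
        using that m t by (intro unit_orbit_nonneg) auto
      have "1 * S t (unit_seq m) k \<le> (real k)\<^sup>2 * S t (unit_seq m) k"
        using k p[OF k] by (intro mult_right_mono) (auto simp: one_le_power)
      also have "\<dots> \<le> (\<Sum>k = 2..m. (real k)\<^sup>2 * S t (unit_seq m) k)"
        using k p by (intro member_le_sum[where f = "\<lambda>k. (real k)\<^sup>2 * S t (unit_seq m) k"]) auto
      finally show ?thesis using \<gamma>(2)[OF t] p[OF k] by simp
    qed
    have "\<forall>\<^sub>F t in at_top. norm (S t (unit_seq m) k) \<le> (real m)\<^sup>2 * exp (- \<gamma> * t)"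
      using eventually_ge_at_top[of 0] by eventually_elim (simp only: real_norm_def bound)
    moreover have "((\<lambda>t. (real m)\<^sup>2 * exp (- \<gamma> * t)) \<longlongrightarrow> 0) at_top"
      by (intro tendsto_mult_right_zero exp_decay_at_top \<gamma>(1))
    ultimately show ?thesis by (rule Lim_null_comparison)
  qed
  have "((\<lambda>t. (w 1 + 1) * (\<Sum>k = 2..m. w k * S t (unit_seq m) k)) \<longlongrightarrow>
      (w 1 + 1) * (\<Sum>k = 2..m. w k * 0)) at_top"
    by (intro tendsto_intros orbit)
  then have "((\<lambda>t. (w 1 + 1) * (\<Sum>k = 2..m. w k * S t (unit_seq m) k)) \<longlongrightarrow> 0) at_top"
    by simp
  moreover have "\<forall>\<^sub>F t in at_top. norm (ell1_norm w (deviation t (unit_seq m))) \<le>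
      (w 1 + 1) * (\<Sum>k = 2..m. w k * S t (unit_seq m) k)"
    using eventually_ge_at_top[of 0]
  proof eventually_elim
    case (elim t)
    have "0 \<le> ell1_norm w (deviation t (unit_seq m))"
      using ell1_norm_nonneg[OF w_weight
          bounded_operator_mem[OF deviation_bounded[OF elim] unit_seq_ell1(1)[OF m]]] .
    then show ?case using deviation_unit_seq_le_tail[OF m elim] by simp
  qed
  ultimately show ?thesis by (rule Lim_null_comparison[rotated])
qed

text \<open>Tannery's theorem for the expansion of \<open>u\<close>: each column norm tends to 0,
  and all are dominated by \<open>(w 1 + 1) * w m\<close>, which is summable against
  \<open>u\<close>.\<close>

lemma deviation_tendsto:
  assumes \<kappa>: "\<kappa> \<le> 1" "weight_cond b w \<kappa>"
    and a_pos: "\<And>j. 2 \<le> j \<Longrightarrow> 0 < a j" and u: "u \<in> ell1 w"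
  shows "((\<lambda>t. ell1_norm w (deviation t u)) \<longlongrightarrow> 0) at_top"
proof -
  define c where "c m t = ell1_norm w (deviation t (unit_seq m))" for m t
  define M where "M m = (w 1 + 1) * (w m * \<bar>u m\<bar>)" for m
  have u0: "u 0 = 0" using u by (simp add: ell1_def)
  have M: "summable M" unfolding M_def by (intro summable_mult ell1_summable u)
  have dev_mem: "deviation t f \<in> ell1 w" if "0 \<le> t" "f \<in> ell1 w" for t f
    using bounded_operator_mem[OF deviation_bounded[OF that(1)] that(2)] .
  \<comment> \<open>Rate 0: the \<open>a j\<close> are positive but may have infimum 0, so the
    domination uses only a bound uniform in time.\<close>
  have tail: "a j * (\<Sum>n = 2..j - 1. w n * b n j) \<le> (a j - 0) * w j" if "2 \<le> j" for j
    using weight_cond_tail[OF \<kappa>, of 0 j] a_pos that by (simp add: less_imp_le)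
  have c_bound: "norm (\<bar>u m\<bar> * c m t) \<le> M m" if "0 \<le> t" for m t
  proof (cases "m = 0")
    case False
    then have m: "1 \<le> m" by simp
    have "0 \<le> c m t" unfolding c_def
      by (intro ell1_norm_nonneg[OF w_weight] dev_mem that unit_seq_ell1(1)[OF m])
    moreover have "c m t \<le> (w 1 + 1) * w m"
      using deviation_decay[of 0, OF tail unit_seq_ell1(1)[OF m] that] unit_seq_ell1(2)[OF m, of w]
      by (simp add: c_def)
    ultimately show ?thesis
      using mult_left_mono[of "c m t" "(w 1 + 1) * w m" "\<bar>u m\<bar>"] by (simp add: M_def mult_ac)
  qed (simp add: u0 M_def)
  have lim: "((\<lambda>t. \<bar>u m\<bar> * c m t) \<longlongrightarrow> 0) at_top" for m
  proof (cases "m = 0")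
    case False
    then have "((\<lambda>t. c m t) \<longlongrightarrow> 0) at_top"
      unfolding c_def by (intro deviation_unit_seq_tendsto a_pos) auto
    then show ?thesis by (rule tendsto_mult_right_zero)
  qed (simp add: u0)
  have "\<forall>\<^sub>F (m, t) in at_top \<times>\<^sub>F at_top. norm (\<bar>u m\<bar> * c m t) \<le> M m"
    using eventually_prodI[OF eventually_True eventually_ge_at_top[of 0]]
    by (rule eventually_mono) (simp only: split_beta c_bound simp_thms)
  then have "((\<lambda>t. \<Sum>m. \<bar>u m\<bar> * c m t) \<longlongrightarrow> 0) at_top"
    using tannerys_theorem[of "\<lambda>m t. \<bar>u m\<bar> * c m t" "\<lambda>_. 0" at_top M] lim M by simp
  moreover have "\<forall>\<^sub>F t in at_top. norm (ell1_norm w (deviation t u)) \<le> (\<Sum>m. \<bar>u m\<bar> * c m t)"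
    using eventually_ge_at_top[of 0]
  proof eventually_elim
    case (elim t)
    have "summable (\<lambda>m. \<bar>u m\<bar> * c m t)"
      using M c_bound[OF elim] by (rule summable_comparison_test')
    then have "ell1_norm w (deviation t u) \<le> (\<Sum>m. \<bar>u m\<bar> * c m t)"
      by (intro bounded_operator_norm_le_suminf[OF w_weight deviation_bounded[OF elim] u])
        (simp_all add: c_def)
    then show ?case using ell1_norm_nonneg[OF w_weight dev_mem[OF elim u]] by simp
  qed
  ultimately show ?thesis by (rule Lim_null_comparison[rotated])
qed

text \<open>The diagonal entry is exactly \<open>exp (- a m * t)\<close>, so after multiplication by
  \<open>exp (\<alpha> * t)\<close> the norm stays at least \<open>w m\<close>. Equality
  \<open>a m = \<alpha>\<close> is included, which at \<open>\<alpha> = 0\<close> gives necessity in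
  part (i).\<close>

lemma not_converges_at_rate:
  assumes m: "2 \<le> m" and \<alpha>: "a m \<le> \<alpha>"
  shows "\<not> converges_at_rate w S \<alpha>"
proof
  have m1: "1 \<le> m" using m by simp
  assume "converges_at_rate w S \<alpha>"
  then have "((\<lambda>t. exp (\<alpha> * t) * ell1_norm w (deviation t (unit_seq m))) \<longlongrightarrow> 0) at_top"
    using unit_seq_ell1(1)[OF m1] by (simp add: converges_at_rate_def deviation_def)
  then have "\<forall>\<^sub>F t in at_top. exp (\<alpha> * t) * ell1_norm w (deviation t (unit_seq m)) < w m"
    using w_pos[OF m1] by (rule order_tendstoD)
  then have "\<forall>\<^sub>F t in at_top. (0::real) \<le> t \<and>
      exp (\<alpha> * t) * ell1_norm w (deviation t (unit_seq m)) < w m"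
    by (intro eventually_conj eventually_ge_at_top)
  then obtain t where t: "0 \<le> t"
    and less: "exp (\<alpha> * t) * ell1_norm w (deviation t (unit_seq m)) < w m"
    using eventually_happens'[OF trivial_limit_at_top_linorder] by blast
  have "w m * \<bar>deviation t (unit_seq m) m\<bar> \<le> ell1_norm w (deviation t (unit_seq m))"
    by (intro weighted_term_le_ell1_norm[OF w_weight]
        bounded_operator_mem[OF deviation_bounded[OF t]] unit_seq_ell1(1)[OF m1])
  moreover have "deviation t (unit_seq m) m = exp (- a m * t)"
    using m unit_orbit_diagonal[OF m1 t] by (simp add: deviation_def e1_def)
  ultimately have "w m * exp (- a m * t) \<le> ell1_norm w (deviation t (unit_seq m))" by simp
  from mult_left_mono[OF this exp_ge_zero, of "\<alpha> * t"] less
  have "exp (\<alpha> * t) * (w m * exp (- a m * t)) < w m" by (rule le_less_trans)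
  moreover have "exp ((\<alpha> - a m) * t) = exp (\<alpha> * t) * exp (- a m * t)"
    unfolding exp_add[symmetric] by (simp add: algebra_simps)
  ultimately have "w m * exp ((\<alpha> - a m) * t) < w m * 1" by (simp add: mult_ac)
  then have "exp ((\<alpha> - a m) * t) < 1" using w_pos[OF m1] by (simp only: mult_less_cancel_left_pos)
  then show False using \<alpha> t by (simp add: mult_less_0_iff)
qed

end

theorem theorem6p4:
  fixes a :: "nat \<Rightarrow> real" and b :: "nat \<Rightarrow> nat \<Rightarrow> real" and w :: "nat \<Rightarrow> real"
    and S :: "real \<Rightarrow> (nat \<Rightarrow> real) \<Rightarrow> (nat \<Rightarrow> real)"
  assumes a_nonneg: "\<forall>n\<ge>1. 0 \<le> a n"
    and b_nonneg: "\<forall>n\<ge>1. \<forall>j\<ge>1. 0 \<le> b n j"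
    and b_upper: "\<forall>n\<ge>1. \<forall>j\<ge>1. n \<ge> j \<longrightarrow> b n j = 0"
    and a_one: "a 1 = 0"
    and mass: "\<forall>j\<ge>2. (\<Sum>n = 1..j - 1. real n * b n j) = real j"
    and w_weight: "weight w"
    and w_ge: "\<forall>n\<ge>1. real n \<le> w n"
    and w_cond: "\<exists>\<kappa>. 0 < \<kappa> \<and> \<kappa> \<le> 1 \<and> weight_cond b w \<kappa>"
    and S_gen: "generates w (op_closure w (op_sum (A_op a w) (B_op a b w))) S"
  shows "((\<forall>u\<in>ell1 w. ((\<lambda>t. ell1_norm w (\<lambda>n. S t u n - M1 u * e1 n)) \<longlongrightarrow> 0) at_top)
           \<longleftrightarrow> (\<forall>n\<ge>2. 0 < a n)) \<and>
    (\<forall>\<kappa>. 0 < \<kappa> \<and> \<kappa> < 1 \<and> weight_cond b w \<kappa> \<longrightarrow>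
      (let a0 = (INF n\<in>{2..}. a n) in
        (\<forall>u\<in>ell1 w. \<forall>t\<ge>0. ell1_norm w (\<lambda>n. S t u n - M1 u * e1 n)
            \<le> (w 1 + 1) * exp (- (1 - \<kappa>) * a0 * t) * ell1_norm w u) \<and>
        (\<forall>\<alpha>. 0 < a0 \<and> 0 \<le> \<alpha> \<and> \<alpha> < (1 - \<kappa>) * a0 \<longrightarrow> converges_at_rate w S \<alpha>) \<and>
        (\<forall>\<alpha>>a0. \<not> converges_at_rate w S \<alpha>) \<and>
        (a0 = 0 \<longrightarrow> (\<forall>\<alpha>>0. \<not> converges_at_rate w S \<alpha>))))"
proof -
  interpret fragmentation_semigroup a b w S
    by unfold_locales (use assms in auto)
  have dev: "(\<lambda>n. S t u n - M1 u * e1 n) = deviation t u" for t u by (simp add: deviation_def)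
  obtain \<kappa>\<^sub>0 where \<kappa>\<^sub>0: "\<kappa>\<^sub>0 \<le> 1" "weight_cond b w \<kappa>\<^sub>0" using w_cond by blast
  \<comment> \<open>Convergence in part (i) is convergence at rate 0, so the obstruction to rates
    applies to it.\<close>
  have rate_zero: "converges_at_rate w S 0 \<longleftrightarrow>
      (\<forall>u\<in>ell1 w. ((\<lambda>t. ell1_norm w (deviation t u)) \<longlongrightarrow> 0) at_top)"
    by (simp add: converges_at_rate_def dev)
  have part1: "(\<forall>u\<in>ell1 w. ((\<lambda>t. ell1_norm w (deviation t u)) \<longlongrightarrow> 0) at_top)
      \<longleftrightarrow> (\<forall>n\<ge>2. 0 < a n)"
  proof
    assume conv: "\<forall>u\<in>ell1 w. ((\<lambda>t. ell1_norm w (deviation t u)) \<longlongrightarrow> 0) at_top"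
    show "\<forall>n\<ge>2. 0 < a n"
    proof (intro allI impI, rule ccontr)
      fix n :: nat assume "2 \<le> n" "\<not> 0 < a n"
      then show False using not_converges_at_rate[of n 0] conv rate_zero by simp
    qed
  next
    assume "\<forall>n\<ge>2. 0 < a n"
    then show "\<forall>u\<in>ell1 w. ((\<lambda>t. ell1_norm w (deviation t u)) \<longlongrightarrow> 0) at_top"
      by (intro ballI deviation_tendsto[OF \<kappa>\<^sub>0]) auto
  qed
  have part2: "let a0 = (INF n\<in>{2..}. a n) in
      (\<forall>u\<in>ell1 w. \<forall>t\<ge>0. ell1_norm w (deviation t u)
          \<le> (w 1 + 1) * exp (- (1 - \<kappa>) * a0 * t) * ell1_norm w u) \<and>
      (\<forall>\<alpha>. 0 < a0 \<and> 0 \<le> \<alpha> \<and> \<alpha> < (1 - \<kappa>) * a0 \<longrightarrow> converges_at_rate w S \<alpha>) \<and>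
      (\<forall>\<alpha>>a0. \<not> converges_at_rate w S \<alpha>) \<and>
      (a0 = 0 \<longrightarrow> (\<forall>\<alpha>>0. \<not> converges_at_rate w S \<alpha>))"
    if \<kappa>: "\<kappa> < 1" "weight_cond b w \<kappa>" for \<kappa>
  proof -
    define a0 where "a0 = (INF n\<in>{2..}. a n)"
    have bdd: "bdd_below (a ` {2..})"
      using a_nonneg by (intro bdd_belowI2[of _ 0]) auto
    have lower: "a0 \<le> a j" if "2 \<le> j" for j
      unfolding a0_def using that by (intro cINF_lower[OF bdd]) simp
    have exponent: "- ((1 - \<kappa>) * a0) * t = - (1 - \<kappa>) * a0 * t" for t
      by (simp only: minus_mult_left)
    have decay: "ell1_norm w (deviation t u) \<le> (w 1 + 1) * exp (- (1 - \<kappa>) * a0 * t) * ell1_norm w u"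
      if "u \<in> ell1 w" "0 \<le> t" for u t
      using deviation_decay[OF weight_cond_tail[OF less_imp_le[OF \<kappa>(1)] \<kappa>(2) lower] that]
      unfolding exponent .
    have rate: "converges_at_rate w S \<alpha>" if \<alpha>: "\<alpha> < (1 - \<kappa>) * a0" for \<alpha>
      unfolding converges_at_rate_def dev
    proof
      fix u assume u: "u \<in> ell1 w"
      \<comment> \<open>The gap between the proved rate and \<open>\<alpha>\<close> leaves a factor
        that still decays.\<close>
      define \<beta> where "\<beta> = (1 - \<kappa>) * a0 - \<alpha>"
      have "((\<lambda>t. (w 1 + 1) * ell1_norm w u * exp (- \<beta> * t)) \<longlongrightarrow> 0) at_top"
        using \<alpha> by (intro tendsto_mult_right_zero exp_decay_at_top) (simp add: \<beta>_def)
      moreover have "\<forall>\<^sub>F t in at_top. norm (exp (\<alpha> * t) * ell1_norm w (deviation t u)) \<le>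
          (w 1 + 1) * ell1_norm w u * exp (- \<beta> * t)"
        using eventually_ge_at_top[of 0]
      proof eventually_elim
        case (elim t)
        have "exp (\<alpha> * t) * exp (- (1 - \<kappa>) * a0 * t) = exp (- \<beta> * t)"
          unfolding exp_add[symmetric] by (simp add: \<beta>_def algebra_simps)
        then have "exp (\<alpha> * t) * ((w 1 + 1) * exp (- (1 - \<kappa>) * a0 * t) * ell1_norm w u) =
            (w 1 + 1) * ell1_norm w u * exp (- \<beta> * t)"
          by (metis mult.commute mult.left_commute)
        moreover have "0 \<le> ell1_norm w (deviation t u)"
          by (intro ell1_norm_nonneg[OF w_weight] bounded_operator_mem[OF deviation_bounded] elim u)
        ultimately show ?case
          using mult_left_mono[OF decay[OF u elim] exp_ge_zero, of "\<alpha> * t"]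
          by (simp only: real_norm_def abs_mult abs_exp_cancel abs_of_nonneg)
      qed
      ultimately show "((\<lambda>t. exp (\<alpha> * t) * ell1_norm w (deviation t u)) \<longlongrightarrow> 0) at_top"
        by (rule Lim_null_comparison[rotated])
    qed
    have no_rate: "\<not> converges_at_rate w S \<alpha>" if "a0 < \<alpha>" for \<alpha>
    proof -
      \<comment> \<open>The infimum may not be attained, but a number above it exceeds some
        \<open>a n\<close>, whose diagonal entry is the obstruction.\<close>
      have "\<exists>n\<in>{2..}. a n < \<alpha>"
        using that cINF_less_iff[OF _ bdd, of \<alpha>] by (simp add: a0_def)
      then show ?thesis using not_converges_at_rate by (auto dest: less_imp_le)
    qed
    show ?thesis
      unfolding Let_def a0_def[symmetric] using decay rate no_rate by blast
  qed
  show ?thesis unfolding dev using part1 part2 by blast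
qed

end
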